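(* Let $\{X_i\}_{i=1}^{\infty}$ be a convolutionary sequence of identically distributed $d$-dimensional random vectors on a sublinear expectation space $(\Omega,\mathcal{H},\mathbb{E})$ with $\mathbb{E}[X_1]=\mathcal{E}[X_1]=0$ and $\mathbb{E}[|X_1|^{2+\delta}]<\infty$ for some $\delta>0$, and let $S_n=\sum_{i=1}^{n}X_i$. Let $X$ be a $d$-dimensional random vector on $(\Omega,\mathcal{H},\mathbb{E})$ following the G-normal distribution characterized by $G(A)=\frac12\mathbb{E}[\langle AX_1,X_1\rangle]$, i.e. $X$ is G-normal distributed and $\frac12\mathbb{E}[\langle AX,X\rangle]=\frac12\mathbb{E}[\langle AX_1,X_1\rangle]$ for every symmetric $d\times d$ real matrix $A$. Then for every continuous function $\varphi:\mathbb{R}^d\to\mathbb{R}$ satisfying the linear growth condition $|\varphi(x)|\le C(1+|x|)$ for some $C>0$, $$\lim_{n\to\infty}\mathbb{E}\Big[\varphi\Big(\frac{1}{\sqrt n}S_n\Big)\Big]=\mathbb{E}[\varphi(X)].$$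
   Context: Here $\mathbb{N}^+=\{1,2,\dots\}$. $C_{l,Lip}(\mathbb{R}^n)$ is the linear space of functions $\varphi:\mathbb{R}^n\to\mathbb{R}$ for which there are $C>0$ and $m\in\mathbb{N}$ with $|\varphi(x)-\varphi(y)|\le C(1+|x|^m+|y|^m)|x-y|$ for all $x,y\in\mathbb{R}^n$. Sublinear expectation space. A triple $(\Omega,\mathcal{H},\mathbb{E})$ where $\mathcal{H}$ is a set of real random variables on $\Omega$ such that $X_1,\dots,X_n\in\mathcal{H}$ implies $\varphi(X_1,\dots,X_n)\in\mathcal{H}$ for every $\varphi\in C_{l,Lip}(\mathbb{R}^n)$, and $\mathbb{E}:\mathcal{H}\to\mathbb{R}$ satisfies, for all $X,Y\in\mathcal{H}$: (1) monotonicity: $X\ge Y$ implies $\mathbb{E}[X]\ge\mathbb{E}[Y]$; (2) $\mathbb{E}[c]=c$ for all $c\in\mathbb{R}$; (3) $\mathbb{E}[X+Y]\le\mathbb{E}[X]+\mathbb{E}[Y]$; (4) $\mathbb{E}[\lambda X]=\lambda\mathbb{E}[X]$ for all $\lambda\ge0$. The conjugate of $\mathbb{E}$ is $\mathcal{E}[X]=-\mathbb{E}[-X]$. An $n$-dimensional random vector is $X=(X_1,\dots,X_n)$ with all $X_j\in\mathcal{H}$; for a random vector, $\mathbb{E}[X]$ and $\mathcal{E}[X]$ are taken componentwise. Convention. For a $d$-dimensional random vector $Y$ and a continuous $\varphi$ of linear growth not in $C_{l,Lip}(\mathbb{R}^d)$, $\mathbb{E}[\varphi(Y)]$ denotes the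 (continuous) extension of $\mathbb{E}$, namely $\mathbb{E}[\varphi(Y)]=\inf\{\mathbb{E}[\psi(Y)]:\psi\in C_{l,Lip}(\mathbb{R}^d),\ \psi\ge\varphi\}$; this agrees with the original value whenever $\varphi(Y)\in\mathcal{H}$. Identical distribution. $d$-dimensional random vectors $X_1,X_2$ on sublinear expectation spaces $(\Omega_1,\mathcal{H}_1,\mathbb{E}_1)$, $(\Omega_2,\mathcal{H}_2,\mathbb{E}_2)$ are identically distributed, $X_1\overset{d}{=}X_2$, if $\mathbb{E}_1[\varphi(X_1)]=\mathbb{E}_2[\varphi(X_2)]$ for every $\varphi\in C_{l,Lip}(\mathbb{R}^d)$. Independence (in the sense of Peng). For random vectors $X$ ($d_1$-dimensional) and $Y$ ($d_2$-dimensional) on $(\Omega,\mathcal{H},\mathbb{E})$, $Y$ is independent from $X$ if $\mathbb{E}[\varphi(X,Y)]=\mathbb{E}\big[\mathbb{E}[\varphi(x,Y)]_{x=X}\big]$ for every $\varphi\in C_{l,Lip}(\mathbb{R}^{d_1+d_2})$. Convolution. For $d$-dimensional random vectors $X,Y$ on $(\Omega,\mathcal{H},\mathbb{E})$, "$Y$ and $X$ are of convolution" means $\mathbb{E}[\varphi(X+Y)]=\mathbb{E}\big[\mathbb{E}[\varphi(x+Y)]_{x=X}\big]$ for every $\varphi\in C_{l,Lip}(\mathbb{R}^d)$. A sequence $\{X_i\}_{i\ge1}$ is convolutionary if for all $n\in\mathbb{N}^+$ and $1\le k\le n$, with $S=\sum_{i=k}^{n}X_i$, one has $\mathbb{E}[\varphi(S+X_{n+1})]=\mathbb{E}\big[\mathbb{E}[\varphi(x+X_{n+1})]_{x=S}\big]$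 for every $\varphi\in C_{l,Lip}(\mathbb{R}^d)$. G-normal distribution. A $d$-dimensional random vector $X$ on $(\Omega,\mathcal{H},\mathbb{E})$ is G-normal distributed if $aX+b\hat X\overset{d}{=}\sqrt{a^2+b^2}\,X$ for all $a,b\ge0$, where $\hat X\overset{d}{=}X$ and $\hat X$ is independent from $X$. *)

theory Defs
  imports "HOL-Analysis.Analysis"
begin

section \<open>Test functions\<close>

definition cl_lip :: "('a::euclidean_space \<Rightarrow> real) \<Rightarrow> bool" where
  "cl_lip \<phi> \<longleftrightarrow> (\<exists>C>0. \<exists>m::nat. \<forall>x y.
     \<bar>\<phi> x - \<phi> y\<bar> \<le> C * (1 + norm x ^ m + norm y ^ m) * norm (x - y))"

text \<open>The same class on Euclidean \<open>n\<close>-space for a dimension \<open>n\<close> that is a variable of the logic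
  rather than a type. A point is the initial segment of length \<open>n\<close> of a sequence; since only this
  segment enters the right-hand side, the inequality forces \<open>\<phi>\<close> to depend on it alone.\<close>

definition cl_lip_dim :: "nat \<Rightarrow> ((nat \<Rightarrow> real) \<Rightarrow> real) \<Rightarrow> bool" where
  "cl_lip_dim n \<phi> \<longleftrightarrow> (\<exists>C>0. \<exists>m::nat. \<forall>x y.
     \<bar>\<phi> x - \<phi> y\<bar> \<le> C * (1 + L2_set x {..<n} ^ m + L2_set y {..<n} ^ m)
                       * L2_set (\<lambda>i. x i - y i) {..<n})"


section \<open>Sublinear expectation spaces\<close>

text \<open>The sample space is the type \<open>'w\<close>. The functional \<open>E\<close> is a total function of the logic, but
  nothing is known about its values outside \<open>H\<close>.\<close>

locale sublinear_expectation_space =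
  fixes H :: "('w \<Rightarrow> real) set"
    and E :: "('w \<Rightarrow> real) \<Rightarrow> real"
  assumes closed: "\<And>n Z \<phi>. n \<ge> 1 \<Longrightarrow> (\<And>i. i < n \<Longrightarrow> Z i \<in> H) \<Longrightarrow> cl_lip_dim n \<phi>
                     \<Longrightarrow> (\<lambda>\<omega>. \<phi> (\<lambda>i. Z i \<omega>)) \<in> H"
    and mono: "\<And>Y Z. Y \<in> H \<Longrightarrow> Z \<in> H \<Longrightarrow> (\<And>\<omega>. Y \<omega> \<ge> Z \<omega>) \<Longrightarrow> E Y \<ge> E Z"
    and const_mem: "\<And>c. (\<lambda>_. c) \<in> H"
    and const: "\<And>c. E (\<lambda>_. c) = c"
    and subadd: "\<And>Y Z. Y \<in> H \<Longrightarrow> Z \<in> H \<Longrightarrow> E (\<lambda>\<omega>. Y \<omega> + Z \<omega>) \<le> E Y + E Z"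
    and pos_hom: "\<And>Z c. Z \<in> H \<Longrightarrow> c \<ge> 0 \<Longrightarrow> E (\<lambda>\<omega>. c * Z \<omega>) = c * E Z"

definition conj_expectation :: "(('w \<Rightarrow> real) \<Rightarrow> real) \<Rightarrow> ('w \<Rightarrow> real) \<Rightarrow> real" where
  "conj_expectation E Z = - E (\<lambda>\<omega>. - Z \<omega>)"

definition random_vector :: "('w \<Rightarrow> real) set \<Rightarrow> ('w \<Rightarrow> real ^ 'd) \<Rightarrow> bool" where
  "random_vector H X \<longleftrightarrow> (\<forall>j. (\<lambda>\<omega>. X \<omega> $ j) \<in> H)"

definition componentwise :: "(('w \<Rightarrow> real) \<Rightarrow> real) \<Rightarrow> ('w \<Rightarrow> real ^ 'd) \<Rightarrow> real ^ 'd" where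
  "componentwise F X = (\<chi> j. F (\<lambda>\<omega>. X \<omega> $ j))"

text \<open>The extension of \<open>E[\<phi>(Y)]\<close> to continuous \<open>\<phi>\<close> of linear growth. For such \<open>\<phi>\<close> the set of
  values is nonempty and bounded below, so the infimum is the genuine one. On the original test
  functions the extension agrees with \<open>E\<close> (lemma \<open>ext_expectation_eq\<close> below), so it can be used for
  all continuous \<open>\<phi>\<close> of linear growth.\<close>

definition ext_expectation ::
    "(('w \<Rightarrow> real) \<Rightarrow> real) \<Rightarrow> ('a::euclidean_space \<Rightarrow> real) \<Rightarrow> ('w \<Rightarrow> 'a) \<Rightarrow> real" where
  "ext_expectation E \<phi> Y =
     (INF \<psi> \<in> {\<psi>. cl_lip \<psi> \<and> (\<forall>y. \<psi> y \<ge> \<phi> y)}. E (\<lambda>\<omega>. \<psi> (Y \<omega>)))"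


section \<open>Distributions, independence, convolution\<close>

definition ident_distr ::
    "(('v \<Rightarrow> real) \<Rightarrow> real) \<Rightarrow> ('v \<Rightarrow> 'a::euclidean_space) \<Rightarrow>
     (('w \<Rightarrow> real) \<Rightarrow> real) \<Rightarrow> ('w \<Rightarrow> 'a) \<Rightarrow> bool" where
  "ident_distr E1 X1 E2 X2 \<longleftrightarrow>
     (\<forall>\<phi>. cl_lip \<phi> \<longrightarrow> E1 (\<lambda>\<omega>. \<phi> (X1 \<omega>)) = E2 (\<lambda>\<omega>. \<phi> (X2 \<omega>)))"

text \<open>\<open>Y\<close> is independent from \<open>X\<close>; the relation is not symmetric.  The norm on the product type is
  the Euclidean one.\<close>

definition indep_from ::
    "(('w \<Rightarrow> real) \<Rightarrow> real) \<Rightarrow> ('w \<Rightarrow> 'b::euclidean_space) \<Rightarrow> ('w \<Rightarrow> 'a::euclidean_space) \<Rightarrow> bool" where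
  "indep_from E Y X \<longleftrightarrow>
     (\<forall>\<phi> :: 'a \<times> 'b \<Rightarrow> real. cl_lip \<phi> \<longrightarrow>
        E (\<lambda>\<omega>. \<phi> (X \<omega>, Y \<omega>)) = E (\<lambda>\<omega>. E (\<lambda>\<omega>'. \<phi> (X \<omega>, Y \<omega>'))))"

text \<open>\<open>Y\<close> and \<open>X\<close> are of convolution; again the order matters.\<close>

definition of_convolution ::
    "(('w \<Rightarrow> real) \<Rightarrow> real) \<Rightarrow> ('w \<Rightarrow> 'a::euclidean_space) \<Rightarrow> ('w \<Rightarrow> 'a) \<Rightarrow> bool" where
  "of_convolution E Y X \<longleftrightarrow>
     (\<forall>\<phi>. cl_lip \<phi> \<longrightarrow>
        E (\<lambda>\<omega>. \<phi> (X \<omega> + Y \<omega>)) = E (\<lambda>\<omega>. E (\<lambda>\<omega>'. \<phi> (X \<omega> + Y \<omega>'))))"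

text \<open>Sequences are indexed from 1; the entry at index 0 plays no role.\<close>

definition convolutionary ::
    "(('w \<Rightarrow> real) \<Rightarrow> real) \<Rightarrow> (nat \<Rightarrow> 'w \<Rightarrow> 'a::euclidean_space) \<Rightarrow> bool" where
  "convolutionary E X \<longleftrightarrow>
     (\<forall>n k. 1 \<le> k \<and> k \<le> n \<longrightarrow> of_convolution E (X (n + 1)) (\<lambda>\<omega>. \<Sum>i=k..n. X i \<omega>))"

definition G_normal ::
    "('w \<Rightarrow> real) set \<Rightarrow> (('w \<Rightarrow> real) \<Rightarrow> real) \<Rightarrow> ('w \<Rightarrow> real ^ 'd) \<Rightarrow> bool" where
  "G_normal H E X \<longleftrightarrow> random_vector H X \<and>
     (\<exists>X'. random_vector H X' \<and> ident_distr E X' E X \<and> indep_from E X' X \<and>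
        (\<forall>a\<ge>0. \<forall>b\<ge>0. ident_distr E (\<lambda>\<omega>. a *\<^sub>R X \<omega> + b *\<^sub>R X' \<omega>)
                                   E (\<lambda>\<omega>. sqrt (a\<^sup>2 + b\<^sup>2) *\<^sub>R X \<omega>)))"

definition G_fun ::
    "(('w \<Rightarrow> real) \<Rightarrow> real) \<Rightarrow> ('w \<Rightarrow> real ^ 'd) \<Rightarrow> real ^ 'd ^ 'd \<Rightarrow> real" where
  "G_fun E X A = 1/2 * E (\<lambda>\<omega>. (A *v X \<omega>) \<bullet> X \<omega>)"


section \<open>Test functions of random vectors; consistency of the extension\<close>

lemma (in sublinear_expectation_space) cl_lip_mem:
  fixes X :: "'w \<Rightarrow> real ^ 'd" and \<phi> :: "real ^ 'd \<Rightarrow> real"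
  assumes X: "random_vector H X" and \<phi>: "cl_lip \<phi>"
  shows "(\<lambda>\<omega>. \<phi> (X \<omega>)) \<in> H"
proof -
  define n where "n = CARD('d)"
  obtain f :: "nat \<Rightarrow> 'd" where f: "bij_betw f {..<n} UNIV"
    using ex_bij_betw_nat_finite[OF finite[of "UNIV :: 'd set"]]
    unfolding n_def atLeast0LessThan by blast
  define g where "g = inv_into {..<n} f"
  have g: "bij_betw g UNIV {..<n}"
    unfolding g_def by (rule bij_betw_inv_into[OF f])
  have fg: "f (g j) = j" for j
    unfolding g_def using f by (meson UNIV_I bij_betw_inv_into_right)
  define v :: "(nat \<Rightarrow> real) \<Rightarrow> real ^ 'd" where "v = (\<lambda>x. \<chi> j. x (g j))"
  have norm_v: "norm (v x) = L2_set x {..<n}" for x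
    unfolding v_def norm_vec_def L2_set_def
    by (simp add: sum.reindex_bij_betw[OF g, of "\<lambda>i. (x i)\<^sup>2"])
  have diff_v: "v x - v y = v (\<lambda>i. x i - y i)" for x y
    unfolding v_def by (simp add: vec_eq_iff)
  have "cl_lip_dim n (\<lambda>x. \<phi> (v x))"
  proof -
    obtain C m where "C > 0"
      and le: "\<And>x y. \<bar>\<phi> x - \<phi> y\<bar> \<le> C * (1 + norm x ^ m + norm y ^ m) * norm (x - y)"
      using \<phi> unfolding cl_lip_def by blast
    have "\<bar>\<phi> (v x) - \<phi> (v y)\<bar> \<le> C * (1 + L2_set x {..<n} ^ m + L2_set y {..<n} ^ m)
            * L2_set (\<lambda>i. x i - y i) {..<n}" for x y
      using le[of "v x" "v y"] by (simp add: diff_v norm_v)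
    with \<open>C > 0\<close> show ?thesis unfolding cl_lip_dim_def by blast
  qed
  moreover have "n \<ge> 1" unfolding n_def by (simp add: Suc_leI)
  moreover have "(\<lambda>\<omega>. X \<omega> $ f i) \<in> H" for i
    using X unfolding random_vector_def by blast
  ultimately have "(\<lambda>\<omega>. \<phi> (v (\<lambda>i. X \<omega> $ f i))) \<in> H"
    using closed[of n "\<lambda>i \<omega>. X \<omega> $ f i" "\<lambda>x. \<phi> (v x)"] by blast
  moreover have "v (\<lambda>i. X \<omega> $ f i) = X \<omega>" for \<omega>
    unfolding v_def by (simp add: fg vec_eq_iff)
  ultimately show ?thesis by simp
qed

lemma (in sublinear_expectation_space) ext_expectation_eq:
  fixes Y :: "'w \<Rightarrow> real ^ 'd" and \<phi> :: "real ^ 'd \<Rightarrow> real"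
  assumes Y: "random_vector H Y" and \<phi>: "cl_lip \<phi>"
  shows "ext_expectation E \<phi> Y = E (\<lambda>\<omega>. \<phi> (Y \<omega>))"
  unfolding ext_expectation_def
proof (rule cInf_eq_minimum)
  show "E (\<lambda>\<omega>. \<phi> (Y \<omega>)) \<in> (\<lambda>\<psi>. E (\<lambda>\<omega>. \<psi> (Y \<omega>))) ` {\<psi>. cl_lip \<psi> \<and> (\<forall>y. \<phi> y \<le> \<psi> y)}"
    using \<phi> by blast
qed (use cl_lip_mem[OF Y] \<phi> in \<open>auto intro!: mono\<close>)

end

theory Submission
  imports Defs
begin

text \<open>
  The proof compares the iterates of two nonlinear averaging operators on Lipschitz functions. For a
  random vector \<open>Y\<close> and \<open>s \<ge> 0\<close> let \<open>T\<^sub>Y f x = E[f(x + s Y)]\<close>. With \<open>s = 1/sqrt n\<close> the convolution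
  property turns \<open>E[f(S\<^sub>n/sqrt n)]\<close> into the \<open>n\<close>-fold iterate of \<open>T\<close> for \<open>X\<^sub>1\<close> at the origin
  (\<open>expectation_convolutionary_sum\<close>), and the stability of the G-normal law turns \<open>E[f(Z)]\<close> into the
  \<open>n\<close>-fold iterate of \<open>T\<close> for \<open>Z\<close> (\<open>transition_pow_G_normal\<close>). Both vectors are centered and induce
  the same function \<open>G\<close>, so on a function with a uniform second-order Taylor expansion the two
  operators differ only in the remainder, which is of order \<open>s\<^sup>3\<close>
  (\<open>transition_close_on_mollified\<close>).

  The iterates of a Lipschitz function are only Lipschitz. The usual remedy is the regularity theory
  of the G-heat equation; here convexity replaces it. Let \<open>m f\<close> be the convolution of \<open>f\<close> with a
  smooth kernel of radius \<open>r\<close>. The operator \<open>T\<^sub>Y\<close> commutes with translations, and it is convex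
  because \<open>E\<close> is sublinear, so \<open>T\<^sub>Y (m f) \<le> m (T\<^sub>Y f)\<close> (\<open>transition_mollify_le\<close>). Hence, if \<open>P\<close> and \<open>Q\<close> are the operators of two
  vectors with the same \<open>G\<close>, the functions \<open>v\<^sub>k = m (P\<^sup>k f)\<close> satisfy
  \<open>Q v\<^sub>k \<le> P v\<^sub>k + O(s\<^sup>3) \<le> v\<^bsub>k+1\<^esub> + O(s\<^sup>3)\<close>. Iterating gives
  \<open>Q\<^sup>n f \<le> P\<^sup>n f + 2 L r + n O(s\<^sup>3)\<close> for \<open>L\<close>-Lipschitz \<open>f\<close> (\<open>transition_pow_compare\<close>), where the
  implied constant depends only on \<open>L\<close>, \<open>r\<close> and the two laws. The argument is symmetric in \<open>P\<close> and
  \<open>Q\<close>. Since \<open>n s\<^sup>3 = 1/sqrt n\<close>, letting first \<open>n\<close> tend to infinity and then \<open>r\<close> to zero proves the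
  theorem for Lipschitz functions (\<open>clt_lipschitz\<close>).

  A continuous \<open>\<phi>\<close> of linear growth is within \<open>\<epsilon> (1 + |x|\<^sup>2)\<close> of a Lipschitz function
  (\<open>lipschitz_approximation\<close>), and the second moment of \<open>S\<^sub>n/sqrt n\<close> does not depend on \<open>n\<close>
  (\<open>second_moment_convolutionary_sum\<close>), so the general case follows from the Lipschitz one.
\<close>

section \<open>A polynomial bump and its second-order expansion\<close>

text \<open>The positive part costs nothing at second order: where \<open>u\<close> and \<open>u + t\<close> lie on different sides of
  zero, every term is bounded by a multiple of \<open>t\<^sup>4\<close> because then \<open>|u| \<le> |t|\<close>.\<close>

lemma pos_part_pow4_taylor:
  fixes u t :: real
  shows "\<bar>(max 0 (u + t))^4 - (max 0 u)^4 - 4 * (max 0 u)^3 * t - 6 * (max 0 u)^2 * t^2\<bar>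
           \<le> 4 * \<bar>u\<bar> * \<bar>t\<bar>^3 + 11 * t^4"
proof -
  consider "u \<ge> 0" "u + t \<ge> 0" | "u < 0" | "u \<ge> 0" "u + t < 0" by linarith
  then show ?thesis
  proof cases
    case 1
    have "(u + t)^4 - u^4 - 4 * u^3 * t - 6 * u^2 * t^2 = 4 * u * t^3 + t^4"
      by algebra
    moreover have "\<bar>4 * u * t^3 + t^4\<bar> \<le> 4 * \<bar>u\<bar> * \<bar>t\<bar>^3 + 11 * t^4"
    proof -
      have "0 \<le> t^4" by simp
      moreover have "\<bar>4 * u * t^3\<bar> = 4 * \<bar>u\<bar> * \<bar>t\<bar>^3" by (simp add: abs_mult power_abs)
      ultimately show ?thesis by linarith
    qed
    ultimately show ?thesis using 1 by (simp add: max_absorb2)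
  next
    case 2
    have "(max 0 (u + t))^4 \<le> \<bar>t\<bar>^4" using 2 by (intro power_mono) auto
    moreover have "0 \<le> 4 * \<bar>u\<bar> * \<bar>t\<bar>^3" by simp
    moreover have "\<bar>t\<bar>^4 = t^4" by (rule power_even_abs) simp
    moreover have "0 \<le> t^4" by simp
    moreover have "\<bar>(max 0 (u + t))^4 - (max 0 u)^4 - 4 * (max 0 u)^3 * t - 6 * (max 0 u)^2 * t^2\<bar>
        = (max 0 (u + t))^4" using 2 by (simp add: max_absorb1)
    ultimately show ?thesis by linarith
  next
    case 3
    let ?s = "\<bar>t\<bar>"
    have us: "u \<le> ?s" "0 \<le> u" using 3 by auto
    have "u^4 \<le> ?s^4" "u^3 * ?s \<le> ?s^3 * ?s" "u^2 * ?s^2 \<le> ?s^2 * ?s^2"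
      using us by (intro power_mono mult_right_mono; simp)+
    then have "u^4 \<le> t^4" "u^3 * ?s \<le> t^4" "u^2 * t^2 \<le> t^4"
      by (simp_all flip: power_Suc2 power_add)
    moreover have "\<bar>- (u^4) - 4 * u^3 * t - 6 * u^2 * t^2\<bar> \<le> u^4 + 4 * (u^3 * ?s) + 6 * (u^2 * t^2)"
    proof -
      have "\<bar>u^3 * t\<bar> = u^3 * ?s" using us by (simp add: abs_mult)
      moreover have "0 \<le> u^4" "0 \<le> u^2 * t^2" by simp_all
      ultimately show ?thesis by (simp only: abs_le_iff mult.assoc) linarith
    qed
    moreover have "0 \<le> 4 * \<bar>u\<bar> * \<bar>t\<bar>^3" by simp
    ultimately show ?thesis using 3 by (simp add: max_absorb1 max_absorb2)
  qed
qed

text \<open>The kernel is a polynomial of \<open>|w|\<^sup>2\<close> cut off at radius \<open>r\<close>. The fourth power is what makes the cut-off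
  compatible with a cubic Taylor remainder, and it keeps all derivatives explicit polynomials: the
  first- and second-order terms are \<open>bump_lin\<close> and \<open>bump_quad\<close>, the latter including the factor
  one half of the Taylor formula.\<close>

definition bump :: "real \<Rightarrow> 'a::real_inner \<Rightarrow> real" where
  "bump r w = (max 0 (r\<^sup>2 - w \<bullet> w))^4"

definition bump_lin :: "real \<Rightarrow> 'a::real_inner \<Rightarrow> 'a \<Rightarrow> real" where
  "bump_lin r w y = - 8 * (max 0 (r\<^sup>2 - w \<bullet> w))^3 * (w \<bullet> y)"

definition bump_quad :: "real \<Rightarrow> 'a::real_inner \<Rightarrow> 'a \<Rightarrow> real" where
  "bump_quad r w y = - 4 * (max 0 (r\<^sup>2 - w \<bullet> w))^3 * (y \<bullet> y)
                     + 24 * (max 0 (r\<^sup>2 - w \<bullet> w))^2 * (w \<bullet> y)^2"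

lemma bump_support:
  assumes "0 < r" "r \<le> norm w"
  shows "max 0 (r\<^sup>2 - w \<bullet> w) = 0"
  using power_mono[OF assms(2), of 2] assms(1) by (simp add: power2_norm_eq_inner)

lemma bump_eq_0: "0 < r \<Longrightarrow> r \<le> norm w \<Longrightarrow> bump r w = 0"
  by (simp add: bump_def bump_support)

lemma bump_nonneg: "0 \<le> bump r w"
  by (simp add: bump_def)

text \<open>With \<open>u = r\<^sup>2 - |w|\<^sup>2\<close> and \<open>t = -(2 w \<bullet> y + |y|\<^sup>2)\<close>, the shifted kernel is the fourth power of the positive
  part of \<open>u + t\<close>. Expanding it to second order in \<open>t\<close> and sorting by powers of \<open>y\<close> leaves only terms
  of order at least three. For \<open>|y| > 1\<close> every term is bounded by a constant multiple of \<open>|y|\<^sup>3\<close> separately.\<close>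

lemma bump_taylor:
  assumes r: "0 < (r::real)"
  obtains K where "0 \<le> K"
    "\<And>(w::'a::real_inner) y. \<bar>bump r (w + y) - bump r w - bump_lin r w y - bump_quad r w y\<bar>
       \<le> K * norm y ^ 3"
proof -
  \<comment> \<open>Beyond this radius neither \<open>w\<close> nor \<open>w + y\<close> meets the support when \<open>|y| \<le> 1\<close>.\<close>
  define R where "R = r + 1"
  have R: "1 \<le> R" "r \<le> R" using r by (auto simp: R_def)
  \<comment> \<open>\<open>K1\<close> collects the constants of the case \<open>|y| \<le> 1\<close> and \<open>K2\<close> those of the case \<open>|y| > 1\<close>.\<close>
  define K1 where "K1 = 216 * R^5 + 891 * R^4 + 24 * R^5 + 6 * R^4"
  define K2 where "K2 = 2 * R^8 + 8 * R^7 + 28 * R^6"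
  have K: "0 \<le> K1" "0 \<le> K2" using R by (simp_all add: K1_def K2_def)
  have bnd: "\<bar>bump r (w + y) - bump r w - bump_lin r w y - bump_quad r w y\<bar> \<le> (K1 + K2) * norm y ^ 3"
    for w y :: 'a
  proof -
    define a where "a = max 0 (r\<^sup>2 - w \<bullet> w)"
    have a0: "0 \<le> a" by (simp add: a_def)
    have "a \<le> r\<^sup>2" by (simp add: a_def)
    also have "r\<^sup>2 \<le> R\<^sup>2" using R r by (intro power_mono) auto
    finally have aR: "a \<le> R\<^sup>2" .
    have cs: "\<bar>w \<bullet> y\<bar> \<le> norm w * norm y" by (rule Cauchy_Schwarz_ineq2)
    let ?y = "norm y"
    show ?thesis
    proof (cases "?y \<le> 1")
      case True
      show ?thesis
      proof (cases "norm w > R")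
        case True
        have "r \<le> norm (w + y)"
          using True \<open>?y \<le> 1\<close> norm_triangle_ineq2[of w "-y"] by (simp add: R_def)
        moreover have "r \<le> norm w" using True R by simp
        ultimately have "bump r (w + y) = 0" "max 0 (r\<^sup>2 - w \<bullet> w) = 0"
          using bump_eq_0[OF r] bump_support[OF r] by blast+
        then show ?thesis using K by (simp add: bump_def bump_lin_def bump_quad_def)
      next
        case False
        then have wR: "norm w \<le> R" by simp
        define u where "u = r\<^sup>2 - w \<bullet> w"
        define t where "t = - (2 * (w \<bullet> y) + y \<bullet> y)"
        have y3: "?y^4 \<le> ?y^3" using \<open>?y \<le> 1\<close> by (intro power_decreasing) auto
        have wy: "\<bar>w \<bullet> y\<bar> \<le> R * ?y"
          using cs mult_right_mono[OF wR norm_ge_zero[of y]] by linarith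
        have "y \<bullet> y = ?y * ?y" by (simp add: norm_eq_sqrt_inner)
        moreover have "?y * ?y \<le> R * ?y" using \<open>?y \<le> 1\<close> R by (intro mult_right_mono) auto
        ultimately have tb: "\<bar>t\<bar> \<le> 3 * R * ?y"
          using wy inner_ge_zero[of y] unfolding t_def by linarith
        have "w \<bullet> w \<le> R\<^sup>2" using power_mono[OF wR norm_ge_zero, of 2]
          by (simp add: power2_norm_eq_inner)
        moreover have "r\<^sup>2 \<le> R\<^sup>2" "0 \<le> r\<^sup>2" using R r by (auto intro: power_mono)
        ultimately have ub: "\<bar>u\<bar> \<le> 2 * R\<^sup>2"
          using inner_ge_zero[of w] unfolding u_def by linarith
        have e1: "4 * \<bar>u\<bar> * \<bar>t\<bar>^3 \<le> 216 * R^5 * ?y^3"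
        proof -
          have "4 * \<bar>u\<bar> * \<bar>t\<bar>^3 \<le> 4 * (2 * R\<^sup>2) * (3 * R * ?y)^3"
            using ub tb by (intro mult_mono power_mono) auto
          also have "\<dots> = 216 * R^5 * ?y^3" by algebra
          finally show ?thesis .
        qed
        have e2: "11 * t^4 \<le> 891 * R^4 * ?y^3"
        proof -
          have "t^4 \<le> (3 * R * ?y)^4"
            using power_mono[OF tb abs_ge_zero, of 4] by simp
          also have "\<dots> = 81 * R^4 * ?y^4" by (simp add: power_mult_distrib)
          also have "\<dots> \<le> 81 * R^4 * ?y^3" using y3 R by (intro mult_left_mono) auto
          finally show ?thesis by simp
        qed
        have a2: "a^2 \<le> R^4" using power_mono[OF aR a0, of 2] by (simp flip: power_mult)
        have e3: "\<bar>24 * a^2 * (w \<bullet> y) * (y \<bullet> y)\<bar> \<le> 24 * R^5 * ?y^3"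
        proof -
          have "\<bar>24 * a^2 * (w \<bullet> y) * (y \<bullet> y)\<bar> = 24 * a^2 * \<bar>w \<bullet> y\<bar> * ?y^2"
            by (simp add: abs_mult power2_norm_eq_inner)
          also have "\<dots> \<le> 24 * R^4 * (R * ?y) * ?y^2"
            using a2 wy R by (intro mult_mono) auto
          also have "\<dots> = 24 * R^5 * ?y^3" by algebra
          finally show ?thesis .
        qed
        have e4: "\<bar>6 * a^2 * (y \<bullet> y)^2\<bar> \<le> 6 * R^4 * ?y^3"
        proof -
          have "\<bar>6 * a^2 * (y \<bullet> y)^2\<bar> = 6 * a^2 * ?y^4"
            by (simp add: abs_mult flip: power2_norm_eq_inner power_mult)
          also have "\<dots> \<le> 6 * R^4 * ?y^3" using a2 y3 R by (intro mult_mono) auto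
          finally show ?thesis .
        qed
        have "r\<^sup>2 - (w + y) \<bullet> (w + y) = u + t"
          by (simp add: u_def t_def inner_simps inner_commute)
        then have "bump r (w + y) - bump r w - bump_lin r w y - bump_quad r w y
          = ((max 0 (u + t))^4 - a^4 - 4 * a^3 * t - 6 * a^2 * t^2)
            + (24 * a^2 * (w \<bullet> y) * (y \<bullet> y) + 6 * a^2 * (y \<bullet> y)^2)"
          unfolding bump_def bump_lin_def bump_quad_def a_def[symmetric] t_def
          by (simp only:) (simp add: power2_eq_square algebra_simps)
        moreover have "\<bar>(max 0 (u + t))^4 - a^4 - 4 * a^3 * t - 6 * a^2 * t^2\<bar>
            \<le> 4 * \<bar>u\<bar> * \<bar>t\<bar>^3 + 11 * t^4"
          using pos_part_pow4_taylor[of u t] by (simp add: a_def u_def)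
        ultimately have "\<bar>bump r (w + y) - bump r w - bump_lin r w y - bump_quad r w y\<bar> \<le> K1 * ?y^3"
          using e1 e2 e3 e4 unfolding K1_def distrib_right by linarith
        moreover have "0 \<le> K2 * ?y^3" using K by simp
        ultimately show ?thesis by (simp add: distrib_right)
      qed
    next
      case False
      have y13: "?y \<le> ?y^3" "?y^2 \<le> ?y^3" "1 \<le> ?y^3"
        using False power_increasing[of 1 3 ?y] power_increasing[of 2 3 ?y] power_increasing[of 0 3 ?y]
        by simp_all
      have bb: "bump r v \<le> R^8" for v :: 'a
      proof -
        have "max 0 (r\<^sup>2 - v \<bullet> v) \<le> R\<^sup>2" using power_mono[OF R(2), of 2] r
          by (smt (verit) inner_ge_zero zero_le_power2)
        from power_mono[OF this, of 4] show ?thesis by (simp add: bump_def flip: power_mult)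
      qed
      have aw: "a * norm w \<le> a * R"
      proof (cases "norm w \<ge> r")
        case True
        then have "a = 0" unfolding a_def by (rule bump_support[OF r])
        then show ?thesis by simp
      next
        case False
        then show ?thesis using R a0 by (intro mult_left_mono) auto
      qed
      have a12: "a^2 \<le> R^4" "a^3 \<le> R^6"
        using power_mono[OF aR a0, of 2] power_mono[OF aR a0, of 3] by (simp_all flip: power_mult)
      have awy: "a * \<bar>w \<bullet> y\<bar> \<le> a * R * ?y"
        using mult_left_mono[OF cs a0] mult_right_mono[OF aw norm_ge_zero[of y]] by (simp add: mult.assoc)
      have l: "\<bar>bump_lin r w y\<bar> \<le> 8 * R^7 * ?y^3"
      proof -
        have "\<bar>bump_lin r w y\<bar> = 8 * a^2 * (a * \<bar>w \<bullet> y\<bar>)"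
          unfolding bump_lin_def a_def[symmetric] abs_mult
          using a0 by (simp add: power3_eq_cube power2_eq_square)
        also have "\<dots> \<le> 8 * a^2 * (a * R * ?y)"
          using awy a0 by (intro mult_left_mono) auto
        also have "\<dots> = 8 * a^3 * (R * ?y)" by (simp add: power3_eq_cube power2_eq_square)
        also have "\<dots> \<le> 8 * R^6 * (R * ?y^3)"
          using a12 R y13 a0 by (intro mult_mono mult_left_mono) auto
        also have "\<dots> = 8 * R^7 * ?y^3" by algebra
        finally show ?thesis .
      qed
      have q1: "4 * a^3 * ?y^2 \<le> 4 * R^6 * ?y^3"
        using a12 R y13 a0 by (intro mult_mono) auto
      have q2: "24 * (a * \<bar>w \<bullet> y\<bar>)^2 \<le> 24 * R^6 * ?y^3"
      proof -
        have "(a * \<bar>w \<bullet> y\<bar>)^2 \<le> (a * R * ?y)^2" using awy a0 by (intro power_mono) auto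
        also have "\<dots> = a^2 * R^2 * ?y^2" by (simp add: power_mult_distrib)
        also have "\<dots> \<le> R^4 * R^2 * ?y^3" using a12 R y13 a0 by (intro mult_mono) auto
        also have "\<dots> = R^6 * ?y^3" by algebra
        finally show ?thesis by simp
      qed
      have "\<bar>bump_quad r w y\<bar> \<le> 4 * a^3 * ?y^2 + 24 * (a * \<bar>w \<bullet> y\<bar>)^2"
        using abs_triangle_ineq[of "- 4 * a^3 * (y \<bullet> y)" "24 * a^2 * (w \<bullet> y)^2"] a0
        unfolding bump_quad_def a_def[symmetric]
        by (simp add: abs_mult power_mult_distrib power2_norm_eq_inner)
      then have q: "\<bar>bump_quad r w y\<bar> \<le> 28 * R^6 * ?y^3" using q1 q2 by linarith
      have b: "\<bar>bump r (w + y) - bump r w\<bar> \<le> 2 * R^8 * ?y^3"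
      proof -
        have "\<bar>bump r (w + y) - bump r w\<bar> \<le> 2 * R^8 * 1"
          using bb[of "w+y"] bb[of w] bump_nonneg[of r w] bump_nonneg[of r "w+y"] by linarith
        also have "\<dots> \<le> 2 * R^8 * ?y^3" using y13 R by (intro mult_left_mono) auto
        finally show ?thesis .
      qed
      have "\<bar>bump r (w + y) - bump r w - bump_lin r w y - bump_quad r w y\<bar> \<le> K2 * ?y^3"
        using b l q unfolding K2_def distrib_right by linarith
      moreover have "0 \<le> K1 * ?y^3" using K by simp
      ultimately show ?thesis by (simp add: distrib_right)
    qed
  qed
  show thesis by (rule that[of "K1 + K2"]) (use K bnd in auto)
qed

section \<open>Mollification of Lipschitz functions\<close>

definition mollify :: "real \<Rightarrow> ('a::euclidean_space \<Rightarrow> real) \<Rightarrow> 'a \<Rightarrow> real" where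
  "mollify r f x = (\<integral>w. f (x - w) * bump r w \<partial>lborel) / (\<integral>w. bump r (w::'a) \<partial>lborel)"

lemma integrable_continuous_compact_support:
  fixes F :: "'a::euclidean_space \<Rightarrow> 'b::{banach, second_countable_topology}"
  assumes "compact S" "continuous_on S F" "\<And>w. w \<notin> S \<Longrightarrow> F w = 0"
  shows "integrable lborel F"
proof -
  have "integrable lborel (\<lambda>w. indicator S w *\<^sub>R F w)"
    by (rule borel_integrable_compact[OF assms(1,2)])
  moreover have "indicator S w *\<^sub>R F w = F w" for w
    using assms(3)[of w] by (cases "w \<in> S") auto
  ultimately show ?thesis by simp
qed

lemma continuous_on_bump [continuous_intros]:
  "continuous_on A g \<Longrightarrow> continuous_on A (\<lambda>w. bump r (g w))"
  unfolding bump_def by (intro continuous_intros)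

lemma integrable_bump:
  fixes g :: "'a::euclidean_space \<Rightarrow> real"
  assumes "0 < r" "continuous_on (cball 0 r) g"
  shows "integrable lborel (\<lambda>w. g w * bump r w)"
  by (rule integrable_continuous_compact_support[of "cball 0 r"])
     (use assms in \<open>auto intro!: continuous_intros bump_eq_0\<close>)

lemma integrable_bump_1:
  assumes "0 < r"
  shows "integrable lborel (bump r :: 'a::euclidean_space \<Rightarrow> real)"
  using integrable_bump[OF assms, of "\<lambda>_::'a. 1"] by simp

lemma bump_integral_pos:
  assumes "0 < r"
  shows "0 < (\<integral>w. bump r (w::'a::euclidean_space) \<partial>lborel)"
proof -
  let ?c = "(r\<^sup>2 / 2)^4"
  let ?B = "ball (0::'a) (r/2)"
  have "0 < ?c * measure lborel ?B"
    using content_ball_pos[of "r/2" "0::'a"] assms by simp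
  also have "\<dots> = (\<integral>w. ?c * indicator ?B w \<partial>lborel)" by simp
  also have "\<dots> \<le> (\<integral>w. bump r (w::'a) \<partial>lborel)"
  proof (rule integral_mono)
    show "integrable lborel (\<lambda>w::'a. ?c * indicator ?B w)"
      by (intro integrable_mult_right integrable_real_indicator) (simp_all add: emeasure_bounded_finite[unfolded infinity_ennreal_def])
    show "integrable lborel (\<lambda>w::'a. bump r w)"
      using integrable_bump_1[OF assms] by simp
    show "?c * indicator ?B w \<le> bump r w" for w
    proof (cases "w \<in> ?B")
      case True
      then have "(norm w)\<^sup>2 \<le> (r/2)\<^sup>2" by (intro power_mono) auto
      then have "4 * (w \<bullet> w) \<le> r\<^sup>2" by (simp add: power2_norm_eq_inner power_divide)
      then have "r\<^sup>2 / 2 \<le> r\<^sup>2 - w \<bullet> w" using inner_ge_zero[of w] by linarith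
      then have "r\<^sup>2 / 2 \<le> max 0 (r\<^sup>2 - w \<bullet> w)" by (rule max.coboundedI2)
      then show ?thesis using True power_mono[of "r\<^sup>2/2" "max 0 (r\<^sup>2 - w \<bullet> w)" 4] by (simp add: bump_def)
    qed (simp add: bump_nonneg)
  qed
  finally show ?thesis .
qed

lemma mollify_mono_weighted:
  fixes g h :: "'a::euclidean_space \<Rightarrow> real"
  assumes "0 < r" "continuous_on (cball 0 r) g" "continuous_on (cball 0 r) h"
    "\<And>w. norm w \<le> r \<Longrightarrow> g w \<le> h w"
  shows "(\<integral>w. g w * bump r w \<partial>lborel) \<le> (\<integral>w. h w * bump r w \<partial>lborel)"
proof (rule integral_mono)
  show "g w * bump r w \<le> h w * bump r w" for w
    using assms(4)[of w] bump_nonneg[of r w] bump_eq_0[OF assms(1), of w]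
    by (cases "norm w \<le> r") (auto intro: mult_right_mono)
qed (use assms in \<open>auto intro: integrable_bump\<close>)

lemma lipschitz_abs_diff:
  fixes f :: "'a::real_normed_vector \<Rightarrow> real"
  assumes "L-lipschitz_on UNIV f"
  shows "\<bar>f x - f y\<bar> \<le> L * norm (x - y)"
  using lipschitz_onD[OF assms, of x y] by (simp add: dist_norm)

lemma continuous_on_lipschitz_shift:
  fixes f :: "'a::real_normed_vector \<Rightarrow> real"
  assumes "L-lipschitz_on UNIV f"
  shows "continuous_on S (\<lambda>w. f (x - w))"
  by (rule continuous_on_compose2[OF lipschitz_on_continuous_on[OF assms]]) (auto intro: continuous_intros)

text \<open>Comparison of \<open>f\<close> with a function \<open>g\<close> on the support of the kernel passes to the averages. This and
  the reverse inequality below give the closeness, the Lipschitz bound and the discretization of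
  \<open>mollify\<close> by different choices of \<open>g\<close>.\<close>

lemma mollify_le:
  fixes f :: "'a::euclidean_space \<Rightarrow> real"
  assumes r: "0 < r" and f: "L-lipschitz_on UNIV f" and g: "continuous_on (cball 0 r) g"
    and le: "\<And>w. norm w \<le> r \<Longrightarrow> f (x - w) \<le> g w + c"
  shows "mollify r f x \<le> (\<integral>w. g w * bump r w \<partial>lborel) / (\<integral>w. bump r (w::'a) \<partial>lborel) + c"
proof -
  let ?I = "\<integral>w. bump r (w::'a) \<partial>lborel"
  have I: "0 < ?I" by (rule bump_integral_pos[OF r])
  have "(\<integral>w. f (x - w) * bump r w \<partial>lborel) \<le> (\<integral>w. (g w + c) * bump r w \<partial>lborel)"
    by (rule mollify_mono_weighted[OF r continuous_on_lipschitz_shift[OF f]])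
       (use g le in \<open>auto intro: continuous_intros\<close>)
  also have "\<dots> = (\<integral>w. g w * bump r w \<partial>lborel) + c * ?I"
    using integrable_bump[OF r g] integrable_bump_1[OF r, where 'a='a] by (simp add: distrib_right)
  finally show ?thesis using I by (simp add: mollify_def field_simps)
qed

lemma mollify_ge:
  fixes f :: "'a::euclidean_space \<Rightarrow> real"
  assumes r: "0 < r" and f: "L-lipschitz_on UNIV f" and g: "continuous_on (cball 0 r) g"
    and le: "\<And>w. norm w \<le> r \<Longrightarrow> g w \<le> f (x - w) + c"
  shows "(\<integral>w. g w * bump r w \<partial>lborel) / (\<integral>w. bump r (w::'a) \<partial>lborel) \<le> mollify r f x + c"
proof -
  let ?I = "\<integral>w. bump r (w::'a) \<partial>lborel"
  have I: "0 < ?I" by (rule bump_integral_pos[OF r])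
  have cf: "continuous_on (cball 0 r) (\<lambda>w. f (x - w))" by (rule continuous_on_lipschitz_shift[OF f])
  have "(\<integral>w. g w * bump r w \<partial>lborel) \<le> (\<integral>w. (f (x - w) + c) * bump r w \<partial>lborel)"
    by (rule mollify_mono_weighted[OF r g]) (use cf le in \<open>auto intro: continuous_intros\<close>)
  also have "\<dots> = (\<integral>w. f (x - w) * bump r w \<partial>lborel) + c * ?I"
    using integrable_bump[OF r cf] integrable_bump_1[OF r, where 'a='a] by (simp add: distrib_right)
  finally show ?thesis using I by (simp add: mollify_def field_simps)
qed

lemma mollify_close:
  fixes f :: "'a::euclidean_space \<Rightarrow> real"
  assumes r: "0 < r" and f: "L-lipschitz_on UNIV f"
  shows "\<bar>mollify r f x - f x\<bar> \<le> L * r"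
proof -
  let ?I = "\<integral>w. bump r (w::'a) \<partial>lborel"
  have I: "0 < ?I" by (rule bump_integral_pos[OF r])
  have L: "0 \<le> L" by (rule lipschitz_on_nonneg[OF f])
  have close: "\<bar>f (x - w) - f x\<bar> \<le> L * r" if "norm w \<le> r" for w
    using lipschitz_abs_diff[OF f, of "x - w" x] mult_left_mono[OF that L] by simp
  have "mollify r f x \<le> (\<integral>w. f x * bump r (w::'a) \<partial>lborel) / ?I + L * r"
    using mollify_le[OF r f, of "\<lambda>_. f x" x "L * r"] close by (force simp: abs_le_iff)
  moreover have "(\<integral>w. f x * bump r (w::'a) \<partial>lborel) / ?I \<le> mollify r f x + L * r"
    using mollify_ge[OF r f, of "\<lambda>_. f x" x "L * r"] close by (force simp: abs_le_iff)
  moreover have "(\<integral>w. f x * bump r (w::'a) \<partial>lborel) / ?I = f x" using I by simp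
  ultimately show ?thesis by linarith
qed

lemma mollify_lipschitz:
  fixes f :: "'a::euclidean_space \<Rightarrow> real"
  assumes r: "0 < r" and f: "L-lipschitz_on UNIV f"
  shows "L-lipschitz_on UNIV (mollify r f)"
proof (rule lipschitz_onI)
  show L: "0 \<le> L" by (rule lipschitz_on_nonneg[OF f])
  have le: "mollify r f x \<le> mollify r f y + L * norm (x - y)" for x y
  proof -
    have "f (x - w) \<le> f (y - w) + L * norm (x - y)" for w
      using lipschitz_abs_diff[OF f, of "x - w" "y - w"] by simp
    then show ?thesis
      using mollify_le[OF r f continuous_on_lipschitz_shift[OF f, of _ y], of x "L * norm (x - y)"]
      by (simp add: mollify_def)
  qed
  show "dist (mollify r f x) (mollify r f y) \<le> L * dist x y" for x y
    using le[of x y] le[of y x] by (simp add: dist_norm norm_minus_commute abs_le_iff)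
qed

text \<open>A sublinear expectation can be exchanged with finite convex combinations but not, a priori, with
  integrals. A partition of unity of mesh \<open>\<eta>\<close> on the support of the kernel replaces the mollification by a
  finite mixture of translates; the weights do not depend on \<open>f\<close> or \<open>x\<close>, so one mixture serves \<open>f\<close> and
  its image under a translation invariant operator.\<close>

lemma mollify_finite_mixture:
  assumes r: "0 < r" and \<eta>: "0 < (\<eta>::real)"
  obtains Cs :: "'a::euclidean_space set" and wt where "finite Cs" "\<And>c. 0 \<le> wt c" "(\<Sum>c\<in>Cs. wt c) = 1"
    "\<And>L f x. L-lipschitz_on UNIV f \<Longrightarrow> \<bar>mollify r f x - (\<Sum>c\<in>Cs. wt c * f (x - c))\<bar> \<le> L * \<eta>"
proof -
  let ?I = "\<integral>w. bump r (w::'a) \<partial>lborel"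
  have I: "0 < ?I" by (rule bump_integral_pos[OF r])
  have "cball 0 r \<subseteq> (\<Union>c\<in>cball (0::'a) r. ball c \<eta>)" using \<eta> by force
  then obtain Cs where Cs: "Cs \<subseteq> cball (0::'a) r" "finite Cs" "cball 0 r \<subseteq> (\<Union>c\<in>Cs. ball c \<eta>)"
    using compactE_image[OF compact_cball, of "cball (0::'a) r" "\<lambda>c. ball c \<eta>" 0 r] by auto
  define b where "b c w = max 0 (\<eta> - norm (w - c))" for c w :: 'a
  define s where "s w = (\<Sum>c\<in>Cs. b c w)" for w
  define p where "p c w = b c w / s w" for c w
  have b0: "0 \<le> b c w" for c w by (simp add: b_def)
  have s_pos: "0 < s w" if w: "norm w \<le> r" for w
  proof -
    obtain c where "c \<in> Cs" "norm (w - c) < \<eta>"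
      using Cs(3) w by (force simp: dist_norm norm_minus_commute)
    then show ?thesis unfolding s_def
      by (intro sum_pos2[OF Cs(2), of c]) (auto simp: b0 b_def)
  qed
  have cont_b: "continuous_on A (b c)" for A c
    unfolding b_def by (intro continuous_intros)
  have cont_p: "continuous_on (cball 0 r) (p c)" for c
    unfolding p_def s_def by (intro continuous_intros cont_b) (use s_pos in \<open>force simp: s_def\<close>)
  have p_sum: "(\<Sum>c\<in>Cs. p c w) = 1" if "norm w \<le> r" for w
    using s_pos[OF that] by (simp add: p_def s_def flip: sum_divide_distrib)
  define wt where "wt c = (\<integral>w. p c w * bump r w \<partial>lborel) / ?I" for c
  have wt0: "0 \<le> wt c" for c
  proof -
    have "0 \<le> (\<integral>w. p c w * bump r w \<partial>lborel)"
      by (intro Bochner_Integration.integral_nonneg mult_nonneg_nonneg bump_nonneg)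
         (auto simp: p_def s_def b0 sum_nonneg)
    then show ?thesis using I by (simp add: wt_def)
  qed
  have mix: "(\<Sum>c\<in>Cs. wt c * a c) = (\<integral>w. (\<Sum>c\<in>Cs. p c w * a c) * bump r w \<partial>lborel) / ?I" for a
  proof -
    have "(\<integral>w. (\<Sum>c\<in>Cs. p c w * a c) * bump r w \<partial>lborel)
        = (\<integral>w. (\<Sum>c\<in>Cs. a c * (p c w * bump r w)) \<partial>lborel)"
      by (simp add: sum_distrib_left sum_distrib_right mult_ac)
    also have "\<dots> = (\<Sum>c\<in>Cs. \<integral>w. a c * (p c w * bump r w) \<partial>lborel)"
      by (intro Bochner_Integration.integral_sum integrable_mult_right integrable_bump[OF r cont_p])
    also have "\<dots> = (\<Sum>c\<in>Cs. a c * (\<integral>w. p c w * bump r w \<partial>lborel))" by simp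
    finally show ?thesis by (simp add: wt_def sum_divide_distrib mult_ac)
  qed
  have "(\<Sum>c\<in>Cs. wt c) = (\<integral>w. (\<Sum>c\<in>Cs. p c w * 1) * bump r w \<partial>lborel) / ?I"
    using mix[of "\<lambda>_. 1"] by simp
  also have "(\<integral>w. (\<Sum>c\<in>Cs. p c w * 1) * bump r w \<partial>lborel) = ?I"
  proof (rule Bochner_Integration.integral_cong[OF refl])
    show "(\<Sum>c\<in>Cs. p c w * 1) * bump r w = bump r w" for w
      using p_sum[of w] bump_eq_0[OF r, of w] by (cases "norm w \<le> r") auto
  qed
  finally have wt1: "(\<Sum>c\<in>Cs. wt c) = 1" using I by simp
  have "\<bar>mollify r f x - (\<Sum>c\<in>Cs. wt c * f (x - c))\<bar> \<le> L * \<eta>" if f: "L-lipschitz_on UNIV f" for L f x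
  proof -
    have L: "0 \<le> L" by (rule lipschitz_on_nonneg[OF f])
    let ?g = "\<lambda>w. \<Sum>c\<in>Cs. p c w * f (x - c)"
    have close: "\<bar>f (x - w) - ?g w\<bar> \<le> L * \<eta>" if w: "norm w \<le> r" for w
    proof -
      have "f (x - w) - ?g w = (\<Sum>c\<in>Cs. p c w * f (x - w)) - ?g w"
        using p_sum[OF w] by (simp flip: sum_distrib_right)
      also have "\<dots> = (\<Sum>c\<in>Cs. p c w * (f (x - w) - f (x - c)))"
        by (simp add: sum_subtractf right_diff_distrib)
      also have "\<bar>\<dots>\<bar> \<le> (\<Sum>c\<in>Cs. p c w * (L * \<eta>))"
      proof (rule order_trans[OF sum_abs], rule sum_mono)
        fix c assume "c \<in> Cs"
        have p0: "0 \<le> p c w" using s_pos[OF w] by (simp add: p_def b0)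
        have "p c w = 0 \<or> norm (w - c) \<le> \<eta>" by (auto simp: p_def b_def)
        then show "\<bar>p c w * (f (x - w) - f (x - c))\<bar> \<le> p c w * (L * \<eta>)"
        proof
          assume "norm (w - c) \<le> \<eta>"
          then have "\<bar>f (x - w) - f (x - c)\<bar> \<le> L * \<eta>"
            using lipschitz_abs_diff[OF f, of "x - w" "x - c"] mult_left_mono[of "norm (w - c)" \<eta> L] L
            by (simp add: norm_minus_commute)
          then show ?thesis using p0 by (simp add: abs_mult mult_left_mono)
        qed simp
      qed
      also have "\<dots> = L * \<eta>" using p_sum[OF w] by (simp flip: sum_distrib_right)
      finally show ?thesis .
    qed
    have cg: "continuous_on (cball 0 r) ?g" by (intro continuous_intros cont_p)
    have "mollify r f x \<le> (\<Sum>c\<in>Cs. wt c * f (x - c)) + L * \<eta>"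
      unfolding mix by (rule mollify_le[OF r f cg]) (use close in \<open>force simp: abs_le_iff\<close>)
    moreover have "(\<Sum>c\<in>Cs. wt c * f (x - c)) \<le> mollify r f x + L * \<eta>"
      unfolding mix by (rule mollify_ge[OF r f cg]) (use close in \<open>force simp: abs_le_iff\<close>)
    ultimately show ?thesis by linarith
  qed
  with Cs(2) wt0 wt1 show thesis by (intro that[of Cs wt]) auto
qed

section \<open>Uniform Taylor expansion of mollified functions\<close>

lemma integral_lborel_shift:
  fixes F :: "'a::euclidean_space \<Rightarrow> real"
  assumes "F \<in> borel_measurable borel"
  shows "(\<integral>w. F w \<partial>lborel) = (\<integral>w. F (w + y) \<partial>lborel)"
proof -
  have "(\<integral>w. F w \<partial>lborel) = (\<integral>w. F w \<partial>distr lborel borel ((+) y))"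
    by (simp add: lborel_distr_plus)
  also have "\<dots> = (\<integral>w. F (y + w) \<partial>lborel)"
    using assms by (intro integral_distr) auto
  finally show ?thesis by (simp add: add.commute)
qed

definition outer :: "real ^ 'd \<Rightarrow> real ^ 'd ^ 'd" where
  "outer w = (\<chi> i j. w $ i * w $ j)"

lemma outer_quadratic_form: "(outer w *v y) \<bullet> y = (w \<bullet> y)\<^sup>2"
proof -
  have "(outer w *v y) \<bullet> y = (\<Sum>i\<in>UNIV. (\<Sum>j\<in>UNIV. w $ i * w $ j * y $ j) * y $ i)"
    by (simp add: outer_def matrix_vector_mult_def inner_vec_def)
  also have "\<dots> = (\<Sum>i\<in>UNIV. w $ i * y $ i) * (\<Sum>j\<in>UNIV. w $ j * y $ j)"
    unfolding sum_product sum_distrib_right by (intro sum.cong) (auto simp: sum_distrib_left mult_ac)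
  finally show ?thesis by (simp add: inner_vec_def power2_eq_square)
qed

lemma transpose_outer: "transpose (outer w) = outer w"
  by (simp add: outer_def transpose_def mult.commute)

lemma linear_transpose: "linear (transpose :: real ^ 'n ^ 'm \<Rightarrow> real ^ 'm ^ 'n)"
  by (rule linearI) (simp_all add: transpose_def vec_eq_iff)

lemma linear_quadratic_form: "linear (\<lambda>B :: real ^ 'd ^ 'd. (B *v y) \<bullet> y)"
  by (rule linearI)
     (simp_all add: matrix_vector_mult_add_rdistrib inner_add_left scaleR_matrix_vector_assoc[symmetric])

text \<open>After a change of variables all dependence on the increment \<open>y\<close> sits in the kernel, so the expansion
  of the kernel can be integrated against \<open>f(x - w) - f(x)\<close>. Subtracting \<open>f(x)\<close> is harmless since the
  kernel has fixed mass; it makes the integrand bounded by \<open>L |w|\<close> uniformly in \<open>x\<close>, so that \<open>K\<close>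
  depends on the kernel alone. The fourth power of \<open>|y|\<close> appears because the remainder lives on the
  balls of radius \<open>r\<close> around \<open>0\<close> and \<open>-y\<close>, where \<open>|w| \<le> r + |y|\<close>.\<close>

lemma mollify_taylor:
  assumes r: "0 < r"
  obtains K where "0 \<le> K"
    "\<And>L (f :: real ^ 'd \<Rightarrow> real) x. L-lipschitz_on UNIV f \<Longrightarrow>
       \<exists>p A. transpose A = A \<and>
         (\<forall>y. \<bar>mollify r f (x + y) - mollify r f x - p \<bullet> y - 1/2 * ((A *v y) \<bullet> y)\<bar>
            \<le> L * K * (norm y ^ 3 + norm y ^ 4))"
proof -
  obtain K0 where K0: "0 \<le> K0"
    and D: "\<And>(w::real^'d) y. \<bar>bump r (w + y) - bump r w - bump_lin r w y - bump_quad r w y\<bar>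
       \<le> K0 * norm y ^ 3"
    using bump_taylor[OF r] by metis
  define I where "I = (\<integral>w. bump r (w::real^'d) \<partial>lborel)"
  have I: "0 < I" unfolding I_def by (rule bump_integral_pos[OF r])
  define V where "V = measure lborel (cball (0::real^'d) r)"
  have V: "0 \<le> V" "measure lborel (cball (c::real^'d) r) = V" for c
    using r by (simp_all add: V_def content_cball)
  define K where "K = 2 * V * K0 * (r + 1) / I"
  have K: "0 \<le> K" using V K0 r I by (simp add: K_def)
  show thesis
  proof (rule that[OF K])
    fix L and f :: "real ^ 'd \<Rightarrow> real" and x
    assume f: "L-lipschitz_on UNIV f"
    have L: "0 \<le> L" by (rule lipschitz_on_nonneg[OF f])
    \<comment> \<open>\<open>p\<close> and \<open>A\<close> are the averages of the gradient and of the Hessian of the kernel weighted by \<open>h\<close>.\<close>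
    define h where "h w = f (x - w) - f x" for w
    have cont_h: "continuous_on S h" for S
      unfolding h_def by (intro continuous_intros continuous_on_lipschitz_shift[OF f])
    have h_bound: "\<bar>h w\<bar> \<le> L * norm w" for w
      using lipschitz_abs_diff[OF f, of "x - w" x] by (simp add: h_def)
    define a where "a w = max 0 (r\<^sup>2 - w \<bullet> w)" for w :: "real^'d"
    have cont_a: "continuous_on S a" for S unfolding a_def by (intro continuous_intros)
    have a0: "a w = 0" if "w \<notin> cball 0 r" for w
      using that bump_support[OF r, of w] by (simp add: a_def)
    define P where "P w = (h w * (- 8 * a w ^ 3)) *\<^sub>R w" for w
    define M where "M w = (2 * h w) *\<^sub>R ((- 4 * a w ^ 3) *\<^sub>R mat 1 + (24 * a w ^ 2) *\<^sub>R outer w)" for w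
    have int_P: "integrable lborel P"
      by (rule integrable_continuous_compact_support[OF compact_cball[of 0 r]])
         (auto simp: P_def a0 intro!: continuous_intros cont_h cont_a)
    have int_M: "integrable lborel M"
      by (rule integrable_continuous_compact_support[OF compact_cball[of 0 r]])
         (auto simp: M_def a0 outer_def intro!: continuous_intros cont_h cont_a)
    define p where "p = (1 / I) *\<^sub>R (\<integral>w. P w \<partial>lborel)"
    define A where "A = (1 / I) *\<^sub>R (\<integral>w. M w \<partial>lborel)"
    have "transpose (\<integral>w. M w \<partial>lborel) = (\<integral>w. transpose (M w) \<partial>lborel)"
      using linear_transpose int_M
      by (intro integral_bounded_linear[symmetric]) (auto simp: linear_conv_bounded_linear)
    also have "(\<lambda>w. transpose (M w)) = M"
      unfolding M_def linear_cmul[OF linear_transpose] linear_add[OF linear_transpose]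
      by (simp add: transpose_outer)
    finally have symm: "transpose A = A"
      unfolding A_def linear_cmul[OF linear_transpose] by simp
    have lin: "p \<bullet> y = (\<integral>w. h w * bump_lin r w y \<partial>lborel) / I"
      and int_lin: "integrable lborel (\<lambda>w. h w * bump_lin r w y)" for y
    proof -
      have *: "P w \<bullet> y = h w * bump_lin r w y" for w
        by (simp add: P_def bump_lin_def a_def)
      show "p \<bullet> y = (\<integral>w. h w * bump_lin r w y \<partial>lborel) / I"
        using integral_inner_left[OF int_P, of y] by (simp add: p_def *)
      show "integrable lborel (\<lambda>w. h w * bump_lin r w y)"
        using integrable_inner_left[of y lborel P] int_P by (simp add: *)
    qed
    have quad: "1/2 * ((A *v y) \<bullet> y) = (\<integral>w. h w * bump_quad r w y \<partial>lborel) / I"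
      and int_quad: "integrable lborel (\<lambda>w. h w * bump_quad r w y)" for y
    proof -
      let ?T = "\<lambda>B :: real ^ 'd ^ 'd. (B *v y) \<bullet> y"
      have T: "bounded_linear ?T"
        using linear_quadratic_form linear_conv_bounded_linear by blast
      have *: "?T (M w) = 2 * (h w * bump_quad r w y)" for w
        unfolding M_def linear_cmul[OF linear_quadratic_form] linear_add[OF linear_quadratic_form]
        by (simp add: outer_quadratic_form bump_quad_def a_def)
      have "?T (\<integral>w. M w \<partial>lborel) = 2 * (\<integral>w. h w * bump_quad r w y \<partial>lborel)"
        using integral_bounded_linear[OF T int_M] by (simp add: *)
      then show "1/2 * ((A *v y) \<bullet> y) = (\<integral>w. h w * bump_quad r w y \<partial>lborel) / I"
        unfolding A_def linear_cmul[OF linear_quadratic_form] by simp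
      show "integrable lborel (\<lambda>w. h w * bump_quad r w y)"
        using integrable_bounded_linear[OF T int_M] by (simp add: *)
    qed
    have int_b: "integrable lborel (\<lambda>w. h w * bump r (w + y))" for y
    proof (rule integrable_continuous_compact_support[OF compact_cball[of "- y" r]])
      show "h w * bump r (w + y) = 0" if "w \<notin> cball (- y) r" for w
        using that bump_eq_0[OF r, of "w + y"] by (simp add: dist_norm norm_minus_commute add.commute)
    qed (intro continuous_intros cont_h)
    have shift: "mollify r f (x + y) = f x + (\<integral>w. h w * bump r (w + y) \<partial>lborel) / I" for y
    proof -
      have "(\<integral>w. f (x + y - w) * bump r w \<partial>lborel) = (\<integral>w. f (x + y - (w + y)) * bump r (w + y) \<partial>lborel)"
        by (intro integral_lborel_shift borel_measurable_continuous_onI continuous_intros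
            continuous_on_lipschitz_shift[OF f])
      also have "\<dots> = (\<integral>w. h w * bump r (w + y) + f x * bump r (w + y) \<partial>lborel)"
        by (simp add: h_def algebra_simps)
      also have "\<dots> = (\<integral>w. h w * bump r (w + y) \<partial>lborel) + (\<integral>w. f x * bump r (w + y) \<partial>lborel)"
      proof (rule Bochner_Integration.integral_add[OF int_b])
        show "integrable lborel (\<lambda>w. f x * bump r (w + y))"
        proof (rule integrable_continuous_compact_support[OF compact_cball[of "- y" r]])
          show "f x * bump r (w + y) = 0" if "w \<notin> cball (- y) r" for w
            using that bump_eq_0[OF r, of "w + y"] by (simp add: dist_norm norm_minus_commute add.commute)
        qed (intro continuous_intros)
      qed
      also have "(\<integral>w. f x * bump r (w + y) \<partial>lborel) = (\<integral>w. f x * bump r (w::real^'d) \<partial>lborel)"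
        by (intro integral_lborel_shift[symmetric] borel_measurable_continuous_onI continuous_intros)
      also have "\<dots> = f x * I" by (simp add: I_def)
      finally show ?thesis using I by (simp add: mollify_def I_def[symmetric] field_simps)
    qed
    have "\<bar>mollify r f (x + y) - mollify r f x - p \<bullet> y - 1/2 * ((A *v y) \<bullet> y)\<bar>
            \<le> L * K * (norm y ^ 3 + norm y ^ 4)" for y
    proof -
      let ?D = "\<lambda>w. bump r (w + y) - bump r w - bump_lin r w y - bump_quad r w y"
      let ?B = "L * (r + norm y) * (K0 * norm y ^ 3)"
      let ?c = "\<lambda>w. indicator (cball 0 r) w + indicator (cball (- y) r) w :: real"
      have B0: "0 \<le> ?B" using L r K0 by simp
      have int_D: "integrable lborel (\<lambda>w. h w * ?D w)"
        using int_b[of y] int_b[of 0] int_lin[of y] int_quad[of y] by (simp add: right_diff_distrib)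
      have eq: "mollify r f (x + y) - mollify r f x - p \<bullet> y - 1/2 * ((A *v y) \<bullet> y)
          = (\<integral>w. h w * ?D w \<partial>lborel) / I"
        using shift[of y] shift[of 0] int_b[of y] int_b[of 0] int_lin[of y] int_quad[of y]
        unfolding lin quad by (simp add: right_diff_distrib diff_divide_distrib)
      have int_c: "integrable lborel (\<lambda>w::real^'d. ?B * ?c w)"
        by (intro integrable_mult_right Bochner_Integration.integrable_add integrable_real_indicator)
           (simp_all add: emeasure_bounded_finite[unfolded infinity_ennreal_def])
      have "\<bar>\<integral>w. h w * ?D w \<partial>lborel\<bar> \<le> (\<integral>w. \<bar>h w * ?D w\<bar> \<partial>lborel)"
        by (rule integral_abs_bound)
      also have "\<dots> \<le> (\<integral>w. ?B * ?c w \<partial>lborel)"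
      proof (rule integral_mono[OF integrable_abs[OF int_D] int_c])
        fix w :: "real ^ 'd"
        show "\<bar>h w * ?D w\<bar> \<le> ?B * ?c w"
        proof (cases "w \<in> cball 0 r \<or> w \<in> cball (- y) r")
          case True
          then have c1: "1 \<le> ?c w" by (auto simp: indicator_def)
          have "norm w \<le> r + norm y"
          proof (cases "w \<in> cball 0 r")
            case False
            then have "norm (w + y) \<le> r" using True by (simp add: dist_norm norm_minus_commute add.commute)
            then show ?thesis using norm_triangle_ineq2[of w "- y"] by simp
          next
            case True
            then have "norm w \<le> r" by simp
            then show ?thesis using norm_ge_zero[of y] by linarith
          qed
          then have "\<bar>h w\<bar> \<le> L * (r + norm y)"
            using h_bound[of w] mult_left_mono[of "norm w" "r + norm y" L] L by linarith
          then have "\<bar>h w * ?D w\<bar> \<le> ?B"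
            unfolding abs_mult using D[of w y] L r by (intro mult_mono) auto
          also have "\<dots> \<le> ?B * ?c w" using mult_left_mono[OF c1 B0] by simp
          finally show ?thesis .
        next
          case False
          then have "r \<le> norm (w + y)" "r \<le> norm w"
            by (simp_all add: dist_norm norm_minus_commute add.commute)
          then have "bump r (w + y) = 0" "a w = 0"
            using bump_eq_0[OF r] bump_support[OF r] by (auto simp: a_def)
          then have "?D w = 0" by (simp add: bump_def[of r w] bump_lin_def bump_quad_def a_def)
          then show ?thesis using B0 by simp
        qed
      qed
      also have "\<dots> = ?B * (2 * V)"
        using int_c by (simp add: V emeasure_bounded_finite[unfolded infinity_ennreal_def])
      finally have "\<bar>(\<integral>w. h w * ?D w \<partial>lborel) / I\<bar> \<le> ?B * (2 * V) / I"
        using I by (simp add: divide_right_mono)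
      also have "\<dots> = L * (2 * V * K0 / I) * (r * norm y ^ 3 + norm y ^ 4)"
        by (simp add: field_simps power4_eq_xxxx power3_eq_cube)
      also have "\<dots> \<le> L * (2 * V * K0 / I) * ((r + 1) * (norm y ^ 3 + norm y ^ 4))"
        using L V K0 I r by (intro mult_left_mono) (auto simp: field_simps)
      also have "\<dots> = L * K * (norm y ^ 3 + norm y ^ 4)" by (simp add: K_def)
      finally show ?thesis unfolding eq .
    qed
    with symm show "\<exists>p A. transpose A = A \<and>
         (\<forall>y. \<bar>mollify r f (x + y) - mollify r f x - p \<bullet> y - 1/2 * ((A *v y) \<bullet> y)\<bar>
            \<le> L * K * (norm y ^ 3 + norm y ^ 4))" by blast
  qed
qed


section \<open>Test functions of polynomial growth\<close>

text \<open>In this form the growth factors of products and sums combine by adding exponents.\<close>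

lemma cl_lip_iff:
  fixes \<phi> :: "'a::euclidean_space \<Rightarrow> real"
  shows "cl_lip \<phi> \<longleftrightarrow> (\<exists>C m. \<forall>x y. \<bar>\<phi> x - \<phi> y\<bar> \<le> C * (1 + norm x + norm y) ^ m * norm (x - y))"
proof
  assume "cl_lip \<phi>"
  then obtain C m where C: "C > 0"
    and le: "\<And>x y. \<bar>\<phi> x - \<phi> y\<bar> \<le> C * (1 + norm x ^ m + norm y ^ m) * norm (x - y)"
    unfolding cl_lip_def by blast
  have "\<bar>\<phi> x - \<phi> y\<bar> \<le> (C * 3) * (1 + norm x + norm y) ^ m * norm (x - y)" for x y
  proof -
    let ?N = "1 + norm x + norm y"
    have "1 \<le> ?N ^ m" "norm x ^ m \<le> ?N ^ m" "norm y ^ m \<le> ?N ^ m"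
      by (intro one_le_power power_mono; simp)+
    then have "1 + norm x ^ m + norm y ^ m \<le> 3 * ?N ^ m" by linarith
    then have "C * (1 + norm x ^ m + norm y ^ m) * norm (x - y) \<le> C * (3 * ?N ^ m) * norm (x - y)"
      using C by (intro mult_right_mono mult_left_mono) auto
    with le[of x y] show ?thesis by (simp add: mult.assoc)
  qed
  then show "\<exists>C m. \<forall>x y. \<bar>\<phi> x - \<phi> y\<bar> \<le> C * (1 + norm x + norm y) ^ m * norm (x - y)" by blast
next
  assume "\<exists>C m. \<forall>x y. \<bar>\<phi> x - \<phi> y\<bar> \<le> C * (1 + norm x + norm y) ^ m * norm (x - y)"
  then obtain C m where le: "\<And>x y. \<bar>\<phi> x - \<phi> y\<bar> \<le> C * (1 + norm x + norm y) ^ m * norm (x - y)"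
    by blast
  have "\<bar>\<phi> x - \<phi> y\<bar> \<le> ((\<bar>C\<bar> + 1) * 3 ^ m) * (1 + norm x ^ m + norm y ^ m) * norm (x - y)" for x y
  proof -
    let ?M = "max 1 (max (norm x) (norm y))"
    have "(1 + norm x + norm y) ^ m \<le> (3 * ?M) ^ m" by (intro power_mono) auto
    also have "\<dots> = 3 ^ m * ?M ^ m" by (simp add: power_mult_distrib)
    also have "?M ^ m \<le> 1 + norm x ^ m + norm y ^ m"
      by (auto simp: max_def)
    finally have "(1 + norm x + norm y) ^ m \<le> 3 ^ m * (1 + norm x ^ m + norm y ^ m)" by simp
    then have "C * (1 + norm x + norm y) ^ m * norm (x - y)
        \<le> (\<bar>C\<bar> + 1) * (3 ^ m * (1 + norm x ^ m + norm y ^ m)) * norm (x - y)"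
      by (intro mult_right_mono mult_mono) auto
    with le[of x y] show ?thesis by (simp add: mult.assoc)
  qed
  moreover have "0 < (\<bar>C\<bar> + 1) * 3 ^ m" by (intro mult_pos_pos) auto
  ultimately show "cl_lip \<phi>" unfolding cl_lip_def by blast
qed

lemma cl_lip_lipschitz:
  assumes "L-lipschitz_on UNIV f"
  shows "cl_lip f"
  unfolding cl_lip_iff using lipschitz_abs_diff[OF assms]
  by (intro exI[of _ L] exI[of _ "0::nat"]) simp

lemma cl_lip_const: "cl_lip (\<lambda>_. c)"
  using cl_lip_lipschitz[OF lipschitz_on_constant] .

lemma cl_lip_norm: "cl_lip norm"
  unfolding cl_lip_iff by (intro exI[of _ "1::real"] exI[of _ "0::nat"]) (simp add: norm_triangle_ineq3)

lemma cl_lip_inner: "cl_lip (\<lambda>x. p \<bullet> x)"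
  unfolding cl_lip_iff inner_diff_right[symmetric]
  by (intro exI[of _ "norm p"] exI[of _ "0::nat"]) (simp add: Cauchy_Schwarz_ineq2)

lemma cl_lip_add:
  fixes \<phi> \<psi> :: "'a::euclidean_space \<Rightarrow> real"
  assumes "cl_lip \<phi>" "cl_lip \<psi>"
  shows "cl_lip (\<lambda>x. \<phi> x + \<psi> x)"
proof -
  obtain C m where C: "\<And>x y. \<bar>\<phi> x - \<phi> y\<bar> \<le> C * (1 + norm x + norm y) ^ m * norm (x - y)"
    using assms(1) unfolding cl_lip_iff by blast
  obtain D k where D: "\<And>x y. \<bar>\<psi> x - \<psi> y\<bar> \<le> D * (1 + norm x + norm y) ^ k * norm (x - y)"
    using assms(2) unfolding cl_lip_iff by blast
  have "\<bar>(\<phi> x + \<psi> x) - (\<phi> y + \<psi> y)\<bar> \<le> (\<bar>C\<bar> + \<bar>D\<bar>) * (1 + norm x + norm y) ^ (m + k) * norm (x - y)" for x y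
  proof -
    let ?N = "1 + norm x + norm y"
    have "C * ?N ^ m \<le> \<bar>C\<bar> * ?N ^ (m + k)" "D * ?N ^ k \<le> \<bar>D\<bar> * ?N ^ (m + k)"
      by (intro mult_mono power_increasing; simp)+
    then have "C * ?N ^ m * norm (x - y) + D * ?N ^ k * norm (x - y)
        \<le> \<bar>C\<bar> * ?N ^ (m + k) * norm (x - y) + \<bar>D\<bar> * ?N ^ (m + k) * norm (x - y)"
      by (intro add_mono mult_right_mono) auto
    then show ?thesis using C[of x y] D[of x y] unfolding distrib_right by linarith
  qed
  then show ?thesis unfolding cl_lip_iff by blast
qed

lemma cl_lip_mult:
  fixes \<phi> \<psi> :: "'a::euclidean_space \<Rightarrow> real"
  assumes "cl_lip \<phi>" "cl_lip \<psi>"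
  shows "cl_lip (\<lambda>x. \<phi> x * \<psi> x)"
proof -
  have growth: "\<exists>c. 0 \<le> c \<and> (\<forall>x y::'a. \<bar>\<phi> x\<bar> \<le> c * (1 + norm x + norm y) ^ (m + 1))"
    if le: "\<And>x y. \<bar>\<phi> x - \<phi> y\<bar> \<le> C * (1 + norm x + norm y) ^ m * norm (x - y)"
    for \<phi> :: "'a \<Rightarrow> real" and C m
  proof (intro exI[of _ "\<bar>\<phi> 0\<bar> + \<bar>C\<bar>"] conjI allI)
    fix x y :: 'a
    let ?N = "1 + norm x + norm y"
    have "\<bar>\<phi> x\<bar> \<le> \<bar>\<phi> 0\<bar> + C * (1 + norm x) ^ m * norm x"
      using le[of x 0] by simp
    moreover have "C * (1 + norm x) ^ m * norm x \<le> \<bar>C\<bar> * ?N ^ m * ?N"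
      by (intro mult_mono power_mono) auto
    moreover have "\<bar>\<phi> 0\<bar> \<le> \<bar>\<phi> 0\<bar> * ?N ^ (m + 1)"
      using mult_left_mono[OF one_le_power[of ?N "m + 1"], of "\<bar>\<phi> 0\<bar>"] by simp
    moreover have "\<bar>C\<bar> * ?N ^ m * ?N = \<bar>C\<bar> * ?N ^ (m + 1)" by simp
    ultimately show "\<bar>\<phi> x\<bar> \<le> (\<bar>\<phi> 0\<bar> + \<bar>C\<bar>) * ?N ^ (m + 1)"
      unfolding distrib_right by linarith
  qed simp
  obtain C m where C: "\<And>x y. \<bar>\<phi> x - \<phi> y\<bar> \<le> C * (1 + norm x + norm y) ^ m * norm (x - y)"
    using assms(1) unfolding cl_lip_iff by blast
  obtain D k where D: "\<And>x y. \<bar>\<psi> x - \<psi> y\<bar> \<le> D * (1 + norm x + norm y) ^ k * norm (x - y)"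
    using assms(2) unfolding cl_lip_iff by blast
  obtain c where c: "0 \<le> c" "\<And>x y :: 'a. \<bar>\<phi> x\<bar> \<le> c * (1 + norm x + norm y) ^ (m + 1)"
    using growth[OF C] by blast
  obtain e where e: "0 \<le> e" "\<And>x y :: 'a. \<bar>\<psi> x\<bar> \<le> e * (1 + norm x + norm y) ^ (k + 1)"
    using growth[OF D] by blast
  have "\<bar>\<phi> x * \<psi> x - \<phi> y * \<psi> y\<bar>
      \<le> (c * D + e * C) * (1 + norm x + norm y) ^ (m + k + 1) * norm (x - y)" for x y
  proof -
    let ?N = "1 + norm x + norm y"
    have "\<phi> x * \<psi> x - \<phi> y * \<psi> y = \<phi> x * (\<psi> x - \<psi> y) + \<psi> y * (\<phi> x - \<phi> y)"
      by (simp add: algebra_simps)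
    also have "\<bar>\<dots>\<bar> \<le> \<bar>\<phi> x\<bar> * \<bar>\<psi> x - \<psi> y\<bar> + \<bar>\<psi> y\<bar> * \<bar>\<phi> x - \<phi> y\<bar>"
      using abs_triangle_ineq by (simp flip: abs_mult)
    also have "\<dots> \<le> (c * ?N ^ (m + 1)) * (D * ?N ^ k * norm (x - y))
        + (e * ?N ^ (k + 1)) * (C * ?N ^ m * norm (x - y))"
      using c e(1) e(2)[of y x] C D by (intro add_mono mult_mono) (auto simp: add_ac)
    also have "\<dots> = (c * D + e * C) * ?N ^ (m + k + 1) * norm (x - y)"
      by (simp add: power_add algebra_simps)
    finally show ?thesis .
  qed
  then show ?thesis unfolding cl_lip_iff by blast
qed

lemma cl_lip_sum:
  "(\<And>i. i \<in> I \<Longrightarrow> cl_lip (\<phi> i)) \<Longrightarrow> cl_lip (\<lambda>x. \<Sum>i\<in>I. \<phi> i x)"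
  by (induction I rule: infinite_finite_induct) (auto intro: cl_lip_const cl_lip_add)

lemma cl_lip_norm_power: "cl_lip (\<lambda>x. norm x ^ k)"
  by (induction k) (auto intro: cl_lip_const cl_lip_mult cl_lip_norm)

lemma cl_lip_quadratic_form:
  fixes A :: "real ^ 'd ^ 'd"
  shows "cl_lip (\<lambda>x. (A *v x) \<bullet> x)"
proof -
  have "(\<lambda>x. (A *v x) \<bullet> x) = (\<lambda>x. \<Sum>i\<in>UNIV. (A $ i \<bullet> x) * (axis i 1 \<bullet> x))"
    by (auto simp: inner_vec_def[of "A *v _"] matrix_vector_mul_component inner_axis inner_commute[of "axis _ _"])
  then show ?thesis by (auto intro!: cl_lip_sum cl_lip_mult cl_lip_inner)
qed

lemma lipschitz_shift:
  fixes f :: "'a::euclidean_space \<Rightarrow> real"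
  assumes "L-lipschitz_on UNIV f"
  shows "(L * \<bar>s\<bar>)-lipschitz_on UNIV (\<lambda>y. f (x + s *\<^sub>R y))"
proof (rule lipschitz_onI)
  show "dist (f (x + s *\<^sub>R y)) (f (x + s *\<^sub>R z)) \<le> L * \<bar>s\<bar> * dist y z" for y z
    using lipschitz_abs_diff[OF assms, of "x + s *\<^sub>R y" "x + s *\<^sub>R z"]
    by (simp add: dist_norm mult.assoc flip: scaleR_diff_right)
  show "0 \<le> L * \<bar>s\<bar>" using lipschitz_on_nonneg[OF assms] by simp
qed


section \<open>Lipschitz approximation with quadratic error\<close>

text \<open>The approximant is the inf-convolution \<open>g(x) = inf\<^sub>y (\<phi>(y) + L |x - y|)\<close>. It inherits the linear growth
  bound, so far from the origin the quadratic weight absorbs the difference; on a fixed ball it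
  converges uniformly to \<open>\<phi>\<close> as \<open>L\<close> grows, by uniform continuity.\<close>

lemma lipschitz_approximation:
  fixes \<phi> :: "'a::euclidean_space \<Rightarrow> real"
  assumes cont: "continuous_on UNIV \<phi>" and C: "0 < C" and growth: "\<And>x. \<bar>\<phi> x\<bar> \<le> C * (1 + norm x)"
    and \<epsilon>: "0 < \<epsilon>"
  obtains L g where "L-lipschitz_on UNIV g" "\<And>x. \<bar>\<phi> x - g x\<bar> \<le> \<epsilon> * (1 + (norm x)\<^sup>2)"
proof -
  \<comment> \<open>Outside the ball of radius \<open>R\<close> the difference of two functions of growth \<open>C (1 + |x|)\<close> is at most \<open>\<epsilon> |x|\<^sup>2\<close>.\<close>
  define R where "R = max 1 (4 * C / \<epsilon>)"
  have R: "1 \<le> R" "4 * C \<le> \<epsilon> * R" using \<epsilon> by (auto simp: R_def field_simps max_def)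
  have "uniformly_continuous_on (cball 0 (R + 1)) \<phi>"
    by (intro compact_uniformly_continuous continuous_on_subset[OF cont]) auto
  then obtain d0 where d0: "0 < d0"
    "\<And>x y. x \<in> cball 0 (R + 1) \<Longrightarrow> y \<in> cball 0 (R + 1) \<Longrightarrow> dist y x < d0 \<Longrightarrow> dist (\<phi> y) (\<phi> x) < \<epsilon>"
    unfolding uniformly_continuous_on_def using \<epsilon> by metis
  define d where "d = min 1 d0"
  have d: "0 < d" "d \<le> 1" "d \<le> d0" using d0 by (auto simp: d_def)
  \<comment> \<open>With this slope, points at distance at least \<open>d\<close> from \<open>x\<close> cannot undercut \<open>\<phi> x\<close> in the infimum when \<open>|x| \<le> R\<close>.\<close>
  define L where "L = C + 2 * C * (1 + R) / d"
  have L: "C \<le> L" "(L - C) * d = 2 * C * (1 + R)" using C R d by (auto simp: L_def)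
  define g where "g x = (INF y. \<phi> y + L * norm (x - y))" for x
  have below: "- C * (1 + norm x) + (L - C) * norm (x - y) \<le> \<phi> y + L * norm (x - y)" for x y
  proof -
    have "C * norm y \<le> C * (norm x + norm (x - y))"
      using C norm_triangle_ineq4[of x "x - y"] by (intro mult_left_mono) auto
    then show ?thesis using growth[of y] by (simp add: algebra_simps abs_le_iff)
  qed
  have below': "- C * (1 + norm x) \<le> \<phi> y + L * norm (x - y)" for x y
  proof -
    have "0 \<le> (L - C) * norm (x - y)" using L by simp
    then show ?thesis using below[of x y] by linarith
  qed
  have bdd: "bdd_below (range (\<lambda>y. \<phi> y + L * norm (x - y)))" for x
    using below' by (intro bdd_belowI2)
  have g_le: "g x \<le> \<phi> y + L * norm (x - y)" for x y
    unfolding g_def by (rule cINF_lower[OF bdd]) simp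
  have g_ge: "c \<le> g x" if "\<And>y. c \<le> \<phi> y + L * norm (x - y)" for c x
    unfolding g_def using that by (intro cINF_greatest) auto
  have g_le_phi: "g x \<le> \<phi> x" for x using g_le[of x x] by simp
  have "L-lipschitz_on UNIV g"
  proof (rule lipschitz_onI)
    show L0: "0 \<le> L" using L C by simp
    have "g x - L * norm (x - z) \<le> g z" for x z
    proof (rule g_ge)
      fix y
      have "L * norm (x - y) \<le> L * (norm (x - z) + norm (z - y))"
        using L0 norm_triangle_ineq[of "x - z" "z - y"] by (intro mult_left_mono) auto
      then show "g x - L * norm (x - z) \<le> \<phi> y + L * norm (z - y)"
        using g_le[of x y] by (simp add: distrib_left)
    qed
    then show "dist (g x) (g z) \<le> L * dist x z" for x z
      by (smt (verit) dist_norm norm_minus_commute real_norm_def)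
  qed
  moreover have "\<bar>\<phi> x - g x\<bar> \<le> \<epsilon> * (1 + (norm x)\<^sup>2)" for x
  proof (cases "norm x \<le> R")
    case True
    have "\<phi> x - \<epsilon> \<le> g x"
    proof (rule g_ge)
      fix y
      show "\<phi> x - \<epsilon> \<le> \<phi> y + L * norm (x - y)"
      proof (cases "norm (x - y) < d")
        case near: True
        have "norm y \<le> R + 1"
          using near d True norm_triangle_ineq4[of x "x - y"] by simp
        then have "dist (\<phi> y) (\<phi> x) < \<epsilon>"
          using near d True by (intro d0) (auto simp: dist_norm norm_minus_commute)
        moreover have "0 \<le> L * norm (x - y)" using L C by simp
        ultimately show ?thesis unfolding dist_real_def by linarith
      next
        case False
        have "(L - C) * d \<le> (L - C) * norm (x - y)" using False L by (intro mult_left_mono) auto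
        moreover have "C * (1 + norm x) \<le> C * (1 + R)" using True C by (intro mult_left_mono) auto
        ultimately show ?thesis using below[of x y] growth[of x] L \<epsilon> by (simp add: abs_le_iff)
      qed
    qed
    moreover have "0 \<le> \<epsilon> * (norm x)\<^sup>2" using \<epsilon> by simp
    ultimately show ?thesis
      using g_le_phi[of x] unfolding distrib_left mult_1_right abs_le_iff by linarith
  next
    case False
    have "- C * (1 + norm x) \<le> g x" by (rule g_ge) (rule below')
    then have "\<bar>\<phi> x - g x\<bar> \<le> 2 * C * (1 + norm x)"
      using g_le_phi[of x] growth[of x] by (simp add: abs_le_iff)
    also have "\<dots> \<le> 2 * C * (2 * norm x)" using False R C by (intro mult_left_mono) auto
    also have "\<dots> = (4 * C) * norm x" by simp
    also have "\<dots> \<le> (\<epsilon> * norm x) * norm x"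
    proof (rule mult_right_mono)
      have "\<epsilon> * R \<le> \<epsilon> * norm x" using False \<epsilon> by (intro mult_left_mono) auto
      then show "4 * C \<le> \<epsilon> * norm x" using R by linarith
    qed simp
    also have "\<dots> \<le> \<epsilon> * (1 + (norm x)\<^sup>2)" using \<epsilon> by (simp add: power2_eq_square distrib_left)
    finally show ?thesis .
  qed
  ultimately show thesis by (rule that)
qed

section \<open>Sublinear expectations\<close>

context sublinear_expectation_space
begin

lemma lincomb_mem:
  assumes "U \<in> H" "V \<in> H"
  shows "(\<lambda>\<omega>. a * U \<omega> + b * V \<omega>) \<in> H"
proof -
  have "cl_lip_dim 2 (\<lambda>x. a * x 0 + b * x 1)"
    unfolding cl_lip_dim_def
  proof (intro exI[of _ "\<bar>a\<bar> + \<bar>b\<bar> + 1"] exI[of _ "0::nat"] conjI allI)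
    fix x y :: "nat \<Rightarrow> real"
    let ?d = "L2_set (\<lambda>i. x i - y i) {..<2}"
    have d: "\<bar>x i - y i\<bar> \<le> ?d" if "i < 2" for i
      using member_le_L2_set[of "{..<2}" i "\<lambda>i. \<bar>x i - y i\<bar>"]
        that by (simp add: L2_set_def)
    have d0: "0 \<le> ?d" by (rule L2_set_nonneg)
    have "\<bar>a * x 0 + b * x 1 - (a * y 0 + b * y 1)\<bar> = \<bar>a * (x 0 - y 0) + b * (x 1 - y 1)\<bar>"
      by (simp add: algebra_simps)
    also have "\<dots> \<le> \<bar>a\<bar> * \<bar>x 0 - y 0\<bar> + \<bar>b\<bar> * \<bar>x 1 - y 1\<bar>"
      using abs_triangle_ineq by (simp flip: abs_mult)
    also have "\<dots> \<le> \<bar>a\<bar> * ?d + \<bar>b\<bar> * ?d"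
      using d[of 0] d[of 1] by (intro add_mono mult_left_mono) auto
    also have "\<dots> \<le> (\<bar>a\<bar> + \<bar>b\<bar> + 1) * 3 * ?d"
      using d0 by (simp add: algebra_simps)
    finally show "\<bar>a * x 0 + b * x 1 - (a * y 0 + b * y 1)\<bar>
        \<le> (\<bar>a\<bar> + \<bar>b\<bar> + 1) * (1 + L2_set x {..<2} ^ 0 + L2_set y {..<2} ^ 0) * ?d" by simp
  qed simp
  from closed[of 2 "\<lambda>i. if i = 0 then U else V", OF _ _ this] assms show ?thesis
    by (simp split: if_splits)
qed

lemma add_mem: "U \<in> H \<Longrightarrow> V \<in> H \<Longrightarrow> (\<lambda>\<omega>. U \<omega> + V \<omega>) \<in> H"
  using lincomb_mem[of U V 1 1] by simp

lemma cmult_mem: "U \<in> H \<Longrightarrow> (\<lambda>\<omega>. c * U \<omega>) \<in> H"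
  using lincomb_mem[of U U c 0] by simp

lemma sum_mem: "(\<And>i. i \<in> I \<Longrightarrow> U i \<in> H) \<Longrightarrow> (\<lambda>\<omega>. \<Sum>i\<in>I. U i \<omega>) \<in> H"
  by (induction I rule: infinite_finite_induct) (auto intro: add_mem const_mem)

lemma E_add_const:
  assumes "U \<in> H"
  shows "E (\<lambda>\<omega>. U \<omega> + c) = E U + c"
proof (rule antisym)
  show "E (\<lambda>\<omega>. U \<omega> + c) \<le> E U + c"
    using subadd[OF assms const_mem[of c]] by (simp add: const)
  have "(\<lambda>\<omega>. U \<omega> + c) \<in> H" using add_mem[OF assms const_mem] .
  from subadd[OF this const_mem[of "- c"]] show "E U + c \<le> E (\<lambda>\<omega>. U \<omega> + c)"
    by (simp add: const)
qed

lemma E_le_add_const: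
  assumes "U \<in> H" "V \<in> H" "\<And>\<omega>. U \<omega> \<le> V \<omega> + c"
  shows "E U \<le> E V + c"
  using mono[of "\<lambda>\<omega>. V \<omega> + c" U] add_mem[OF assms(2) const_mem[of c]] assms
  by (simp add: E_add_const)

lemma E_le_add_cmult:
  assumes "U \<in> H" "V \<in> H" "W \<in> H" "0 \<le> c" "\<And>\<omega>. U \<omega> \<le> V \<omega> + c * W \<omega>"
  shows "E U \<le> E V + c * E W"
proof -
  have "E U \<le> E (\<lambda>\<omega>. V \<omega> + c * W \<omega>)"
    using assms by (intro mono add_mem cmult_mem)
  also have "\<dots> \<le> E V + E (\<lambda>\<omega>. c * W \<omega>)" using assms by (intro subadd cmult_mem)
  finally show ?thesis using pos_hom assms by simp
qed

text \<open>A variable without mean uncertainty behaves linearly: it can be added and removed by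
  subadditivity. This is why the first-order Taylor terms disappear.\<close>

lemma E_add_null:
  assumes "U \<in> H" "V \<in> H" "E U = 0" "E (\<lambda>\<omega>. - U \<omega>) = 0"
  shows "E (\<lambda>\<omega>. U \<omega> + V \<omega>) = E V"
proof (rule antisym)
  show "E (\<lambda>\<omega>. U \<omega> + V \<omega>) \<le> E V" using subadd[OF assms(1,2)] assms(3) by simp
  have "(\<lambda>\<omega>. - U \<omega>) \<in> H" using cmult_mem[OF assms(1), of "- 1"] by simp
  from subadd[OF add_mem[OF assms(1,2)] this] show "E V \<le> E (\<lambda>\<omega>. U \<omega> + V \<omega>)"
    using assms(4) by simp
qed

lemma E_sum_le:
  assumes "finite I" "\<And>i. i \<in> I \<Longrightarrow> U i \<in> H"
  shows "E (\<lambda>\<omega>. \<Sum>i\<in>I. U i \<omega>) \<le> (\<Sum>i\<in>I. E (U i))"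
  using assms
proof (induction I rule: finite_induct)
  case (insert i I)
  then show ?case using subadd[of "U i" "\<lambda>\<omega>. \<Sum>i\<in>I. U i \<omega>"] sum_mem[of I U] by auto
qed (simp add: const)

end

section \<open>Transition operators of random vectors\<close>

text \<open>For fixed \<open>s\<close> and \<open>Y\<close> this is a monotone, convex operator on Lipschitz functions that is invariant under
  translations and commutes with the addition of constants; the proof uses only these features and
  its expansion for small \<open>s\<close>.\<close>

definition transition :: "(('w \<Rightarrow> real) \<Rightarrow> real) \<Rightarrow> real \<Rightarrow> ('w \<Rightarrow> real ^ 'd) \<Rightarrow>
    (real ^ 'd \<Rightarrow> real) \<Rightarrow> real ^ 'd \<Rightarrow> real" where
  "transition E s Y f x = E (\<lambda>\<omega>. f (x + s *\<^sub>R Y \<omega>))"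

text \<open>Letting \<open>p\<close> range over both signs, this says that the upper and the lower mean of every linear
  functional of \<open>Y\<close> vanish.\<close>

definition centered :: "(('w \<Rightarrow> real) \<Rightarrow> real) \<Rightarrow> ('w \<Rightarrow> real ^ 'd) \<Rightarrow> bool" where
  "centered E Y \<longleftrightarrow> (\<forall>p. E (\<lambda>\<omega>. p \<bullet> Y \<omega>) = 0)"

context sublinear_expectation_space
begin

lemma lipschitz_mem:
  fixes f :: "real ^ 'd \<Rightarrow> real"
  assumes "random_vector H Y" "L-lipschitz_on UNIV f"
  shows "(\<lambda>\<omega>. f (x + s *\<^sub>R Y \<omega>)) \<in> H"
  by (rule cl_lip_mem[OF assms(1) cl_lip_lipschitz[OF lipschitz_shift[OF assms(2)]]])

lemma inner_mem: "random_vector H Y \<Longrightarrow> (\<lambda>\<omega>. p \<bullet> Y \<omega>) \<in> H"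
  by (rule cl_lip_mem[OF _ cl_lip_inner])

lemma transition_le:
  fixes Y :: "'w \<Rightarrow> real ^ 'd"
  assumes Y: "random_vector H Y" and "L-lipschitz_on UNIV f" "L'-lipschitz_on UNIV g"
    and "\<And>x. f x \<le> g x + c"
  shows "transition E s Y f x \<le> transition E s Y g x + c"
  unfolding transition_def using assms by (intro E_le_add_const lipschitz_mem)

lemma transition_lipschitz:
  fixes Y :: "'w \<Rightarrow> real ^ 'd"
  assumes Y: "random_vector H Y" and f: "L-lipschitz_on UNIV f"
  shows "L-lipschitz_on UNIV (transition E s Y f)"
proof (rule lipschitz_onI)
  show "0 \<le> L" by (rule lipschitz_on_nonneg[OF f])
  have "transition E s Y f x \<le> transition E s Y f y + L * norm (x - y)" for x y
    unfolding transition_def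
  proof (rule E_le_add_const)
    show "f (x + s *\<^sub>R Y \<omega>) \<le> f (y + s *\<^sub>R Y \<omega>) + L * norm (x - y)" for \<omega>
      using lipschitz_abs_diff[OF f, of "x + s *\<^sub>R Y \<omega>" "y + s *\<^sub>R Y \<omega>"] by simp
  qed (intro lipschitz_mem[OF Y f])+
  then show "dist (transition E s Y f x) (transition E s Y f y) \<le> L * dist x y" for x y
    by (smt (verit) dist_norm norm_minus_commute real_norm_def)
qed

text \<open>Jensen's inequality for the convex, translation invariant operator \<open>transition E s Y\<close>. Finite
  subadditivity gives it for finite mixtures of translates, and \<open>mollify_finite_mixture\<close> approximates
  both sides by the same mixture uniformly.\<close>

lemma transition_mollify_le:
  fixes Y :: "'w \<Rightarrow> real ^ 'd"
  assumes Y: "random_vector H Y" and r: "0 < r" and f: "L-lipschitz_on UNIV f"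
  shows "transition E s Y (mollify r f) x \<le> mollify r (transition E s Y f) x"
proof (rule field_le_epsilon)
  fix e :: real assume e: "0 < e"
  have L: "0 \<le> L" by (rule lipschitz_on_nonneg[OF f])
  define \<eta> where "\<eta> = e / (2 * (L + 1))"
  have \<eta>: "0 < \<eta>" "2 * (L * \<eta>) \<le> e" using e L by (auto simp: \<eta>_def field_simps)
  obtain Cs :: "(real ^ 'd) set" and wt where Cs: "finite Cs" "\<And>c. 0 \<le> wt c" "(\<Sum>c\<in>Cs. wt c) = 1"
    and mix: "\<And>L f x. L-lipschitz_on UNIV f \<Longrightarrow> \<bar>mollify r f x - (\<Sum>c\<in>Cs. wt c * f (x - c))\<bar> \<le> L * \<eta>"
    using mollify_finite_mixture[OF r \<eta>(1), where 'a="real ^ 'd"] by metis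
  have mem: "(\<lambda>\<omega>. f (x - c + s *\<^sub>R Y \<omega>)) \<in> H" for c by (rule lipschitz_mem[OF Y f])
  have "transition E s Y (mollify r f) x \<le> E (\<lambda>\<omega>. \<Sum>c\<in>Cs. wt c * f (x - c + s *\<^sub>R Y \<omega>)) + L * \<eta>"
    unfolding transition_def
  proof (rule E_le_add_const)
    show "mollify r f (x + s *\<^sub>R Y \<omega>) \<le> (\<Sum>c\<in>Cs. wt c * f (x - c + s *\<^sub>R Y \<omega>)) + L * \<eta>" for \<omega>
      using mix[OF f, of "x + s *\<^sub>R Y \<omega>"] by (simp add: algebra_simps abs_le_iff)
  qed (intro lipschitz_mem[OF Y mollify_lipschitz[OF r f]] sum_mem cmult_mem mem)+
  also have "E (\<lambda>\<omega>. \<Sum>c\<in>Cs. wt c * f (x - c + s *\<^sub>R Y \<omega>))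
      \<le> (\<Sum>c\<in>Cs. E (\<lambda>\<omega>. wt c * f (x - c + s *\<^sub>R Y \<omega>)))"
    by (intro E_sum_le Cs cmult_mem mem)
  also have "\<dots> = (\<Sum>c\<in>Cs. wt c * transition E s Y f (x - c))"
    unfolding transition_def using pos_hom[OF mem Cs(2)] by simp
  also have "\<dots> \<le> mollify r (transition E s Y f) x + L * \<eta>"
    using mix[OF transition_lipschitz[OF Y f], of s x] by (simp add: abs_le_iff)
  finally show "transition E s Y (mollify r f) x \<le> mollify r (transition E s Y f) x + e"
    using \<eta> by simp
qed

text \<open>Centering removes the linear Taylor term, and positive homogeneity turns the quadratic one into
  \<open>s\<^sup>2 G(A)\<close>. The moments on the right are those of elements of \<open>H\<close>, since powers of the norm are
  test functions.\<close>

lemma transition_taylor: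
  fixes Y :: "'w \<Rightarrow> real ^ 'd"
  assumes Y: "random_vector H Y" and centered: "centered E Y" and s: "0 \<le> s" "s \<le> 1"
    and v: "L-lipschitz_on UNIV v" and M: "0 \<le> M"
    and taylor: "\<And>y. \<bar>v (x + y) - v x - p \<bullet> y - 1/2 * ((A *v y) \<bullet> y)\<bar> \<le> M * (norm y ^ 3 + norm y ^ 4)"
  shows "\<bar>transition E s Y v x - (v x + s\<^sup>2 * G_fun E Y A)\<bar>
           \<le> M * s ^ 3 * E (\<lambda>\<omega>. norm (Y \<omega>) ^ 3 + norm (Y \<omega>) ^ 4)"
proof -
  let ?V = "\<lambda>\<omega>. v (x + s *\<^sub>R Y \<omega>)"
  let ?W = "\<lambda>\<omega>. norm (Y \<omega>) ^ 3 + norm (Y \<omega>) ^ 4"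
  let ?l = "\<lambda>\<omega>. (s *\<^sub>R p) \<bullet> Y \<omega>"
  let ?q = "\<lambda>\<omega>. s\<^sup>2 / 2 * ((A *v Y \<omega>) \<bullet> Y \<omega>)"
  \<comment> \<open>The Taylor polynomial of the function at \<open>x\<close>, evaluated at the increment \<open>s Y\<close>.\<close>
  let ?U = "\<lambda>\<omega>. ?l \<omega> + ?q \<omega> + v x"
  have V: "?V \<in> H" by (rule lipschitz_mem[OF Y v])
  have W: "?W \<in> H" by (intro add_mem cl_lip_mem[OF Y] cl_lip_norm_power)
  have l: "?l \<in> H" by (rule inner_mem[OF Y])
  have q': "(\<lambda>\<omega>. (A *v Y \<omega>) \<bullet> Y \<omega>) \<in> H" by (rule cl_lip_mem[OF Y cl_lip_quadratic_form])
  have q: "?q \<in> H" by (intro cmult_mem q')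
  have U: "?U \<in> H" by (intro add_mem l q const_mem)
  have "E ?l = 0" "E (\<lambda>\<omega>. - ?l \<omega>) = 0"
    using centered[unfolded centered_def, rule_format, of "s *\<^sub>R p"]
      centered[unfolded centered_def, rule_format, of "- (s *\<^sub>R p)"] by simp_all
  then have "E (\<lambda>\<omega>. ?l \<omega> + ?q \<omega>) = E ?q" by (intro E_add_null l q)
  then have EU: "E ?U = v x + s\<^sup>2 * G_fun E Y A"
    using E_add_const[OF add_mem[OF l q], of "v x"] pos_hom[OF q', of "s\<^sup>2 / 2"]
    by (simp add: G_fun_def)
  have close: "\<bar>?V \<omega> - ?U \<omega>\<bar> \<le> (M * s ^ 3) * ?W \<omega>" for \<omega>
  proof -
    have "s ^ 4 \<le> s ^ 3" using s by (intro power_decreasing) auto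
    then have "M * (norm (s *\<^sub>R Y \<omega>) ^ 3 + norm (s *\<^sub>R Y \<omega>) ^ 4) \<le> M * (s ^ 3 * ?W \<omega>)"
      using s M by (intro mult_left_mono) (auto simp: power_mult_distrib distrib_left mult_right_mono)
    moreover have "1/2 * ((A *v (s *\<^sub>R Y \<omega>)) \<bullet> (s *\<^sub>R Y \<omega>)) = ?q \<omega>"
      by (simp add: matrix_vector_mult_scaleR power2_eq_square)
    moreover have "p \<bullet> (s *\<^sub>R Y \<omega>) = ?l \<omega>" by simp
    ultimately show ?thesis using taylor[of "s *\<^sub>R Y \<omega>"] unfolding mult.assoc by linarith
  qed
  have "0 \<le> M * s ^ 3" using M s by simp
  moreover have "?V \<omega> \<le> ?U \<omega> + M * s ^ 3 * ?W \<omega>" "?U \<omega> \<le> ?V \<omega> + M * s ^ 3 * ?W \<omega>" for \<omega>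
    using close[of \<omega>] by linarith+
  ultimately have "E ?V \<le> E ?U + M * s ^ 3 * E ?W" "E ?U \<le> E ?V + M * s ^ 3 * E ?W"
    using E_le_add_cmult[OF V U W] E_le_add_cmult[OF U V W] by blast+
  then show ?thesis unfolding transition_def EU by (simp add: abs_le_iff)
qed

text \<open>The Taylor coefficients \<open>p\<close> and \<open>A\<close> belong to the mollified function and are the same for both
  vectors; as the vectors share \<open>G\<close>, the second-order terms cancel in the difference.\<close>

lemma transition_close_on_mollified:
  fixes Y Z :: "'w \<Rightarrow> real ^ 'd"
  assumes Y: "random_vector H Y" "centered E Y" and Z: "random_vector H Z" "centered E Z"
    and G: "\<And>A :: real ^ 'd ^ 'd. transpose A = A \<Longrightarrow> G_fun E Y A = G_fun E Z A" and r: "0 < r"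
  obtains K where "\<And>L (f :: real ^ 'd \<Rightarrow> real) s x. L-lipschitz_on UNIV f \<Longrightarrow> 0 \<le> s \<Longrightarrow> s \<le> 1 \<Longrightarrow>
     \<bar>transition E s Y (mollify r f) x - transition E s Z (mollify r f) x\<bar> \<le> L * K * s ^ 3"
proof -
  obtain K where K: "0 \<le> K"
    "\<And>L (f :: real ^ 'd \<Rightarrow> real) x. L-lipschitz_on UNIV f \<Longrightarrow>
       \<exists>p A. transpose A = A \<and>
         (\<forall>y. \<bar>mollify r f (x + y) - mollify r f x - p \<bullet> y - 1/2 * ((A *v y) \<bullet> y)\<bar>
            \<le> L * K * (norm y ^ 3 + norm y ^ 4))"
    using mollify_taylor[OF r, where 'd='d] by metis
  let ?m = "\<lambda>Y :: 'w \<Rightarrow> real ^ 'd. E (\<lambda>\<omega>. norm (Y \<omega>) ^ 3 + norm (Y \<omega>) ^ 4)"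
  show thesis
  proof (rule that[of "K * (?m Y + ?m Z)"])
    fix L s and f :: "real ^ 'd \<Rightarrow> real" and x
    assume f: "L-lipschitz_on UNIV f" and s: "0 \<le> s" "s \<le> (1::real)"
    have LK: "0 \<le> L * K" using lipschitz_on_nonneg[OF f] K by simp
    obtain p A where A: "transpose A = A"
      and taylor: "\<And>y. \<bar>mollify r f (x + y) - mollify r f x - p \<bullet> y - 1/2 * ((A *v y) \<bullet> y)\<bar>
            \<le> L * K * (norm y ^ 3 + norm y ^ 4)"
      using K(2)[OF f] by metis
    note * = transition_taylor[OF _ _ s mollify_lipschitz[OF r f] LK taylor]
    show "\<bar>transition E s Y (mollify r f) x - transition E s Z (mollify r f) x\<bar>
        \<le> L * (K * (?m Y + ?m Z)) * s ^ 3"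
      using *[OF Y] *[OF Z] G[OF A] by (simp add: algebra_simps abs_le_iff)
  qed
qed

lemma transition_pow_lipschitz:
  fixes Y :: "'w \<Rightarrow> real ^ 'd"
  assumes "random_vector H Y" "L-lipschitz_on UNIV f"
  shows "L-lipschitz_on UNIV ((transition E s Y ^^ k) f)"
  by (induction k) (use assms transition_lipschitz in auto)

lemma transition_pow_le:
  fixes Y :: "'w \<Rightarrow> real ^ 'd"
  assumes "random_vector H Y" "L-lipschitz_on UNIV f" "L'-lipschitz_on UNIV g" "\<And>x. f x \<le> g x + c"
  shows "(transition E s Y ^^ k) f x \<le> (transition E s Y ^^ k) g x + c"
proof (induction k arbitrary: x)
  case (Suc k)
  then show ?case
    using transition_le[OF assms(1) transition_pow_lipschitz[OF assms(1,2)] transition_pow_lipschitz[OF assms(1,3)]]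
    by simp
qed (use assms in simp)

text \<open>The central comparison. The mollified iterates \<open>mollify r (P\<^sup>k f)\<close> are smooth enough for the one-step
  estimate, and by Jensen's inequality they are supersolutions of the recursion for \<open>P\<close>; hence they
  dominate the recursion for \<open>Q\<close> up to \<open>\<epsilon>\<close> per step. Mollifying at the start and removing the
  mollification at the end costs \<open>L r\<close> each, because the iterates keep the Lipschitz constant.\<close>

lemma transition_pow_compare:
  fixes Y Z :: "'w \<Rightarrow> real ^ 'd"
  assumes Y: "random_vector H Y" and Z: "random_vector H Z" and r: "0 < r" and f: "L-lipschitz_on UNIV f"
    and close: "\<And>g x. L-lipschitz_on UNIV g \<Longrightarrow>
      transition E s Y (mollify r g) x \<le> transition E s Z (mollify r g) x + \<epsilon>"
  shows "(transition E s Y ^^ n) f x \<le> (transition E s Z ^^ n) f x + (2 * L * r + real n * \<epsilon>)"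
proof -
  let ?Q = "transition E s Y" and ?P = "transition E s Z"
  note lipP = transition_pow_lipschitz[OF Z f]
  note lipm = mollify_lipschitz[OF r f]
  have "(?Q ^^ k) (mollify r f) x \<le> mollify r ((?P ^^ k) f) x + real k * \<epsilon>" for k x
  proof (induction k arbitrary: x)
    case (Suc k)
    have "(?Q ^^ Suc k) (mollify r f) x \<le> ?Q (mollify r ((?P ^^ k) f)) x + real k * \<epsilon>"
      using transition_le[OF Y transition_pow_lipschitz[OF Y lipm] mollify_lipschitz[OF r lipP] Suc.IH]
      by simp
    also have "?Q (mollify r ((?P ^^ k) f)) x \<le> ?P (mollify r ((?P ^^ k) f)) x + \<epsilon>"
      by (rule close[OF lipP])
    also have "?P (mollify r ((?P ^^ k) f)) x \<le> mollify r ((?P ^^ Suc k) f) x"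
      using transition_mollify_le[OF Z r lipP] by simp
    finally show ?case by (simp add: algebra_simps)
  qed simp
  moreover have "(?Q ^^ n) f x \<le> (?Q ^^ n) (mollify r f) x + L * r"
  proof (rule transition_pow_le[OF Y f lipm])
    show "f x \<le> mollify r f x + L * r" for x using mollify_close[OF r f, of x] by linarith
  qed
  moreover have "mollify r ((?P ^^ n) f) x \<le> (?P ^^ n) f x + L * r"
    using mollify_close[OF r lipP, of n s x] by (simp add: abs_le_iff)
  ultimately show ?thesis by (smt (verit) mult_2 distrib_right)
qed

end

section \<open>Convolutionary sums and G-normal vectors\<close>

lemma ident_distrD:
  "ident_distr E1 X1 E2 X2 \<Longrightarrow> cl_lip \<phi> \<Longrightarrow> E1 (\<lambda>\<omega>. \<phi> (X1 \<omega>)) = E2 (\<lambda>\<omega>. \<phi> (X2 \<omega>))"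
  by (simp add: ident_distr_def)

lemma convolutionaryD:
  assumes "convolutionary E X" "1 \<le> n" "cl_lip \<phi>"
  shows "E (\<lambda>\<omega>. \<phi> ((\<Sum>i=1..n. X i \<omega>) + X (n + 1) \<omega>))
       = E (\<lambda>\<omega>. E (\<lambda>\<omega>'. \<phi> ((\<Sum>i=1..n. X i \<omega>) + X (n + 1) \<omega>')))"
  using assms unfolding convolutionary_def of_convolution_def by blast

context sublinear_expectation_space
begin

text \<open>The components have upper and lower mean zero, so subadditivity bounds the upper mean of each linear
  functional by zero; applied to \<open>p\<close> and \<open>-p\<close> this forces equality.\<close>

lemma centered_of_components:
  fixes Y :: "'w \<Rightarrow> real ^ 'd"
  assumes Y: "random_vector H Y"
    and up: "componentwise E Y = 0" and low: "componentwise (conj_expectation E) Y = 0"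
  shows "centered E Y"
proof -
  have comp: "(\<lambda>\<omega>. Y \<omega> $ j) \<in> H" for j using Y by (simp add: random_vector_def)
  have Ej: "E (\<lambda>\<omega>. Y \<omega> $ j) = 0" "E (\<lambda>\<omega>. - Y \<omega> $ j) = 0" for j
    using up low by (simp_all add: componentwise_def conj_expectation_def vec_eq_iff)
  have Ecj: "E (\<lambda>\<omega>. c * Y \<omega> $ j) = 0" for c j
  proof (cases "0 \<le> c")
    case True
    then show ?thesis using pos_hom[OF comp] Ej by simp
  next
    case False
    have "(\<lambda>\<omega>. - Y \<omega> $ j) \<in> H" using cmult_mem[OF comp, of "- 1"] by simp
    from pos_hom[OF this, of "- c"] False show ?thesis using Ej by simp
  qed
  have le: "E (\<lambda>\<omega>. p \<bullet> Y \<omega>) \<le> 0" for p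
    using E_sum_le[of UNIV "\<lambda>j \<omega>. p $ j * Y \<omega> $ j"] cmult_mem[OF comp]
    by (simp add: inner_vec_def Ecj)
  have "0 \<le> E (\<lambda>\<omega>. p \<bullet> Y \<omega>)" for p
    using subadd[OF inner_mem[OF Y, of p] inner_mem[OF Y, of "- p"]] le[of "- p"]
    by (simp add: const)
  with le show ?thesis by (auto simp: centered_def intro: antisym)
qed

lemma random_vector_sum:
  fixes Y :: "'i \<Rightarrow> 'w \<Rightarrow> real ^ 'd"
  assumes "\<And>i. i \<in> I \<Longrightarrow> random_vector H (Y i)"
  shows "random_vector H (\<lambda>\<omega>. \<Sum>i\<in>I. Y i \<omega>)"
  using assms by (auto simp: random_vector_def intro!: sum_mem)

lemma random_vector_scaleR:
  fixes Y :: "'w \<Rightarrow> real ^ 'd"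
  assumes "random_vector H Y"
  shows "random_vector H (\<lambda>\<omega>. c *\<^sub>R Y \<omega>)"
  using assms by (auto simp: random_vector_def intro!: cmult_mem)

text \<open>The convolution property splits off the last summand, which may be replaced by a copy of \<open>X 1\<close>. What
  remains is the sum of the first \<open>n\<close> terms tested with the function \<open>transition E s (X 1) f\<close>, again
  Lipschitz with the same constant.\<close>

lemma expectation_convolutionary_sum:
  fixes X :: "nat \<Rightarrow> 'w \<Rightarrow> real ^ 'd"
  assumes conv: "convolutionary E X" and ident: "\<And>i. i \<ge> 1 \<Longrightarrow> ident_distr E (X i) E (X 1)"
    and X: "random_vector H (X 1)" and f: "L-lipschitz_on UNIV f"
  shows "E (\<lambda>\<omega>. f (s *\<^sub>R (\<Sum>i=1..n. X i \<omega>))) = (transition E s (X 1) ^^ n) f 0"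
  using f
proof (induction n arbitrary: f)
  case 0
  then show ?case by (simp add: const)
next
  case (Suc n)
  show ?case
  proof (cases "n = 0")
    case True
    then show ?thesis by (simp add: transition_def)
  next
    case False
    let ?S = "\<lambda>\<omega>. \<Sum>i=1..n. X i \<omega>"
    have lip: "cl_lip (\<lambda>y. f (x + s *\<^sub>R y))" for x
      by (rule cl_lip_lipschitz[OF lipschitz_shift[OF Suc.prems]])
    have "E (\<lambda>\<omega>. f (s *\<^sub>R (\<Sum>i=1..Suc n. X i \<omega>))) = E (\<lambda>\<omega>. f (0 + s *\<^sub>R (?S \<omega> + X (n + 1) \<omega>)))"
      by simp
    also have "\<dots> = E (\<lambda>\<omega>. E (\<lambda>\<omega>'. f (0 + s *\<^sub>R (?S \<omega> + X (n + 1) \<omega>'))))"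
      using convolutionaryD[OF conv _ lip[of 0], of n] False by simp
    also have "(\<lambda>\<omega>. E (\<lambda>\<omega>'. f (0 + s *\<^sub>R (?S \<omega> + X (n + 1) \<omega>'))))
        = (\<lambda>\<omega>. transition E s (X 1) f (s *\<^sub>R ?S \<omega>))"
    proof
      fix \<omega>
      show "E (\<lambda>\<omega>'. f (0 + s *\<^sub>R (?S \<omega> + X (n + 1) \<omega>'))) = transition E s (X 1) f (s *\<^sub>R ?S \<omega>)"
        using ident_distrD[OF ident lip[of "s *\<^sub>R ?S \<omega>"], of "n + 1"]
        by (simp add: transition_def scaleR_add_right)
    qed
    also have "E (\<lambda>\<omega>. transition E s (X 1) f (s *\<^sub>R ?S \<omega>))
        = (transition E s (X 1) ^^ n) (transition E s (X 1) f) 0"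
      by (rule Suc.IH[OF transition_lipschitz[OF X Suc.prems]])
    finally show ?thesis by (simp add: funpow_swap1)
  qed
qed

text \<open>The cross term in \<open>|x + X|\<^sup>2\<close> is linear in \<open>X\<close> and has no mean uncertainty, so second moments are
  additive although \<open>E\<close> is only sublinear.\<close>

lemma second_moment_convolutionary_sum:
  fixes X :: "nat \<Rightarrow> 'w \<Rightarrow> real ^ 'd"
  assumes conv: "convolutionary E X" and ident: "\<And>i. i \<ge> 1 \<Longrightarrow> ident_distr E (X i) E (X 1)"
    and X: "\<And>i. i \<ge> 1 \<Longrightarrow> random_vector H (X i)" and centered: "centered E (X 1)"
  shows "E (\<lambda>\<omega>. (norm (\<Sum>i=1..n. X i \<omega>))\<^sup>2) = real n * E (\<lambda>\<omega>. (norm (X 1 \<omega>))\<^sup>2)"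
proof (induction n)
  case 0
  then show ?case by (simp add: const)
next
  case (Suc n)
  show ?case
  proof (cases "n = 0")
    case False
    let ?S = "\<lambda>\<omega>. \<Sum>i=1..n. X i \<omega>"
    let ?m = "E (\<lambda>\<omega>. (norm (X 1 \<omega>))\<^sup>2)"
    have X1: "random_vector H (X 1)" using X by simp
    have S: "random_vector H ?S" by (rule random_vector_sum) (use X in auto)
    have sq: "(\<lambda>\<omega>. (norm (Y \<omega>))\<^sup>2) \<in> H" if "random_vector H Y" for Y :: "'w \<Rightarrow> real ^ 'd"
      by (rule cl_lip_mem[OF that cl_lip_norm_power])
    have inner: "E (\<lambda>\<omega>. (norm (x + X (n + 1) \<omega>))\<^sup>2) = (norm x)\<^sup>2 + ?m" for x
    proof -
      have expand: "(norm (x + y))\<^sup>2 = ((2 *\<^sub>R x) \<bullet> y + (norm y)\<^sup>2) + (norm x)\<^sup>2" for y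
        by (simp add: power2_norm_eq_inner inner_simps inner_commute)
      have lip: "cl_lip (\<lambda>y. (norm (x + y))\<^sup>2)"
        unfolding expand by (intro cl_lip_add cl_lip_inner cl_lip_norm_power cl_lip_const)
      have "E (\<lambda>\<omega>. (norm (x + X (n + 1) \<omega>))\<^sup>2) = E (\<lambda>\<omega>. (norm (x + X 1 \<omega>))\<^sup>2)"
        by (rule ident_distrD[OF ident lip]) simp
      also have "\<dots> = E (\<lambda>\<omega>. (2 *\<^sub>R x) \<bullet> X 1 \<omega> + (norm (X 1 \<omega>))\<^sup>2) + (norm x)\<^sup>2"
        unfolding expand by (intro E_add_const add_mem inner_mem sq X1)
      also have "E (\<lambda>\<omega>. (2 *\<^sub>R x) \<bullet> X 1 \<omega> + (norm (X 1 \<omega>))\<^sup>2) = ?m"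
        using centered[unfolded centered_def, rule_format, of "2 *\<^sub>R x"]
          centered[unfolded centered_def, rule_format, of "- (2 *\<^sub>R x)"]
        by (intro E_add_null inner_mem sq X1) simp_all
      finally show ?thesis by simp
    qed
    have "E (\<lambda>\<omega>. (norm (\<Sum>i=1..Suc n. X i \<omega>))\<^sup>2) = E (\<lambda>\<omega>. (norm (?S \<omega> + X (n + 1) \<omega>))\<^sup>2)"
      by simp
    also have "\<dots> = E (\<lambda>\<omega>. E (\<lambda>\<omega>'. (norm (?S \<omega> + X (n + 1) \<omega>'))\<^sup>2))"
      using convolutionaryD[OF conv _ cl_lip_norm_power, of n 2] False by simp
    also have "\<dots> = E (\<lambda>\<omega>. (norm (?S \<omega>))\<^sup>2) + ?m"
      unfolding inner by (rule E_add_const[OF sq[OF S]])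
    finally show ?thesis using Suc.IH by (simp add: algebra_simps)
  qed simp
qed

text \<open>Stability for \<open>a = b = 1\<close> gives \<open>2 E[p \<bullet> Z] = sqrt 2 E[p \<bullet> Z]\<close>.\<close>

lemma G_normal_centered:
  fixes Z :: "'w \<Rightarrow> real ^ 'd"
  assumes G: "G_normal H E Z"
  shows "centered E Z"
  unfolding centered_def
proof
  fix p :: "real ^ 'd"
  obtain Z' where ident: "ident_distr E Z' E Z" and indep: "indep_from E Z' Z"
    and stable: "\<And>a b. 0 \<le> a \<Longrightarrow> 0 \<le> b \<Longrightarrow>
      ident_distr E (\<lambda>\<omega>. a *\<^sub>R Z \<omega> + b *\<^sub>R Z' \<omega>) E (\<lambda>\<omega>. sqrt (a\<^sup>2 + b\<^sup>2) *\<^sub>R Z \<omega>)"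
    and Z: "random_vector H Z"
    using G unfolding G_normal_def by blast
  let ?e = "E (\<lambda>\<omega>. p \<bullet> Z \<omega>)"
  have "cl_lip (\<lambda>z. (p, p) \<bullet> z)" by (rule cl_lip_inner)
  then have "E (\<lambda>\<omega>. p \<bullet> Z \<omega> + p \<bullet> Z' \<omega>) = E (\<lambda>\<omega>. E (\<lambda>\<omega>'. p \<bullet> Z \<omega> + p \<bullet> Z' \<omega>'))"
    using indep unfolding indep_from_def by (auto simp: inner_Pair)
  also have "(\<lambda>\<omega>. E (\<lambda>\<omega>'. p \<bullet> Z \<omega> + p \<bullet> Z' \<omega>')) = (\<lambda>\<omega>. p \<bullet> Z \<omega> + ?e)"
  proof
    fix \<omega>
    have "E (\<lambda>\<omega>'. p \<bullet> Z \<omega> + p \<bullet> Z' \<omega>') = E (\<lambda>\<omega>'. p \<bullet> Z \<omega> + p \<bullet> Z \<omega>')"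
      by (rule ident_distrD[OF ident cl_lip_add[OF cl_lip_const cl_lip_inner]])
    also have "\<dots> = p \<bullet> Z \<omega> + ?e" using E_add_const[OF inner_mem[OF Z], of p "p \<bullet> Z \<omega>"]
      by (simp add: add.commute[of "p \<bullet> Z \<omega>"])
    finally show "E (\<lambda>\<omega>'. p \<bullet> Z \<omega> + p \<bullet> Z' \<omega>') = p \<bullet> Z \<omega> + ?e" .
  qed
  also have "E (\<lambda>\<omega>. p \<bullet> Z \<omega> + ?e) = ?e + ?e" by (rule E_add_const[OF inner_mem[OF Z]])
  finally have "E (\<lambda>\<omega>. p \<bullet> Z \<omega> + p \<bullet> Z' \<omega>) = 2 * ?e" by simp
  moreover have "E (\<lambda>\<omega>. p \<bullet> Z \<omega> + p \<bullet> Z' \<omega>) = sqrt 2 * ?e"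
    using ident_distrD[OF stable[of 1 1] cl_lip_inner[of p]] pos_hom[OF inner_mem[OF Z, of p], of "sqrt 2"]
    by (simp add: inner_add_right)
  ultimately have "(2 - sqrt 2) * ?e = 0" by (simp add: algebra_simps)
  moreover have "sqrt 2 < (2::real)" by (rule real_less_lsqrt) auto
  ultimately show "?e = 0" by simp
qed

text \<open>The operators of a G-normal vector form a semigroup in \<open>s\<^sup>2\<close>: by independence one step after \<open>k\<close> steps
  adds an independent copy, and stability merges \<open>s Z + s sqrt k Z'\<close> into \<open>s sqrt (k + 1) Z\<close>.\<close>

lemma transition_pow_G_normal:
  fixes Z :: "'w \<Rightarrow> real ^ 'd"
  assumes G: "G_normal H E Z" and f: "L-lipschitz_on UNIV f" and s: "0 \<le> s"
  shows "(transition E s Z ^^ k) f x = E (\<lambda>\<omega>. f (x + (s * sqrt (real k)) *\<^sub>R Z \<omega>))"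
proof (induction k arbitrary: x)
  case 0
  then show ?case by (simp add: const)
next
  case (Suc k)
  obtain Z' where ident: "ident_distr E Z' E Z" and indep: "indep_from E Z' Z"
    and stable: "\<And>a b. 0 \<le> a \<Longrightarrow> 0 \<le> b \<Longrightarrow>
      ident_distr E (\<lambda>\<omega>. a *\<^sub>R Z \<omega> + b *\<^sub>R Z' \<omega>) E (\<lambda>\<omega>. sqrt (a\<^sup>2 + b\<^sup>2) *\<^sub>R Z \<omega>)"
    using G unfolding G_normal_def by blast
  define t where "t = s * sqrt (real k)"
  have t: "0 \<le> t" using s by (simp add: t_def)
  let ?g = "\<lambda>z :: (real ^ 'd) \<times> (real ^ 'd). f (x + (s *\<^sub>R fst z + t *\<^sub>R snd z))"
  have g: "cl_lip ?g"
  proof (rule cl_lip_lipschitz, rule lipschitz_onI)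
    have L: "0 \<le> L" by (rule lipschitz_on_nonneg[OF f])
    then show "0 \<le> L * (s + t)" using s t by simp
    fix y z :: "(real ^ 'd) \<times> (real ^ 'd)"
    have "norm (s *\<^sub>R (fst y - fst z) + t *\<^sub>R (snd y - snd z))
        \<le> s * norm (fst (y - z)) + t * norm (snd (y - z))"
      using norm_triangle_ineq[of "s *\<^sub>R (fst y - fst z)" "t *\<^sub>R (snd y - snd z)"] s t by simp
    also have "\<dots> \<le> s * norm (y - z) + t * norm (y - z)"
      using s t norm_fst_le[of "fst (y - z)" "snd (y - z)"] norm_snd_le[of "snd (y - z)" "fst (y - z)"]
      unfolding prod.collapse by (intro add_mono mult_left_mono) auto
    finally have "norm (s *\<^sub>R (fst y - fst z) + t *\<^sub>R (snd y - snd z)) \<le> (s + t) * norm (y - z)"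
      by (simp add: distrib_right)
    then have "L * norm (s *\<^sub>R (fst y - fst z) + t *\<^sub>R (snd y - snd z)) \<le> L * ((s + t) * norm (y - z))"
      using L by (rule mult_left_mono)
    moreover have "\<bar>?g y - ?g z\<bar> \<le> L * norm (s *\<^sub>R (fst y - fst z) + t *\<^sub>R (snd y - snd z))"
      using lipschitz_abs_diff[OF f, of "x + (s *\<^sub>R fst y + t *\<^sub>R snd y)" "x + (s *\<^sub>R fst z + t *\<^sub>R snd z)"]
      by (simp add: algebra_simps)
    ultimately show "dist (?g y) (?g z) \<le> L * (s + t) * dist y z"
      by (simp add: dist_norm mult.assoc)
  qed
  have lip: "cl_lip (\<lambda>y. f (x' + c *\<^sub>R y))" for x' c
    by (rule cl_lip_lipschitz[OF lipschitz_shift[OF f]])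
  have "(transition E s Z ^^ Suc k) f x = E (\<lambda>\<omega>. E (\<lambda>\<omega>'. f (x + s *\<^sub>R Z \<omega> + t *\<^sub>R Z \<omega>')))"
    by (simp add: transition_def[of E s Z "_ f"] Suc.IH t_def)
  also have "\<dots> = E (\<lambda>\<omega>. E (\<lambda>\<omega>'. f (x + s *\<^sub>R Z \<omega> + t *\<^sub>R Z' \<omega>')))"
    by (subst ident_distrD[OF ident lip]) (rule refl)
  also have "\<dots> = E (\<lambda>\<omega>. f (x + (s *\<^sub>R Z \<omega> + t *\<^sub>R Z' \<omega>)))"
    using indep[unfolded indep_from_def, rule_format, OF g] by (simp add: add.assoc)
  also have "\<dots> = E (\<lambda>\<omega>. f (x + sqrt (s\<^sup>2 + t\<^sup>2) *\<^sub>R Z \<omega>))"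
    using ident_distrD[OF stable[OF s t] lip[of x 1]] by simp
  also have "sqrt (s\<^sup>2 + t\<^sup>2) = s * sqrt (real (Suc k))"
  proof -
    have "s\<^sup>2 + t\<^sup>2 = s\<^sup>2 * real (Suc k)" by (simp add: t_def power_mult_distrib distrib_left)
    then show ?thesis using s by (simp add: real_sqrt_mult)
  qed
  finally show ?case .
qed

end

section \<open>The central limit theorem\<close>

context sublinear_expectation_space
begin

text \<open>The function \<open>g + \<epsilon> (1 + |x|\<^sup>2)\<close> is admissible in the infimum defining the extension, and every
  admissible function dominates \<open>g - \<epsilon> (1 + |x|\<^sup>2)\<close>.\<close>

lemma ext_expectation_close:
  fixes Y :: "'w \<Rightarrow> real ^ 'd"
  assumes Y: "random_vector H Y" and g: "L-lipschitz_on UNIV g" and \<epsilon>: "0 \<le> \<epsilon>"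
    and close: "\<And>x. \<bar>\<phi> x - g x\<bar> \<le> \<epsilon> * (1 + (norm x)\<^sup>2)"
  shows "\<bar>ext_expectation E \<phi> Y - E (\<lambda>\<omega>. g (Y \<omega>))\<bar> \<le> \<epsilon> * (1 + E (\<lambda>\<omega>. (norm (Y \<omega>))\<^sup>2))"
proof -
  let ?W = "\<lambda>\<omega>. 1 + (norm (Y \<omega>))\<^sup>2"
  have gl: "cl_lip g" by (rule cl_lip_lipschitz[OF g])
  have gH: "(\<lambda>\<omega>. g (Y \<omega>)) \<in> H" by (rule cl_lip_mem[OF Y gl])
  have sq: "(\<lambda>\<omega>. (norm (Y \<omega>))\<^sup>2) \<in> H" by (rule cl_lip_mem[OF Y cl_lip_norm_power])
  have W: "?W \<in> H" by (rule add_mem[OF const_mem sq])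
  have EW: "E ?W = 1 + E (\<lambda>\<omega>. (norm (Y \<omega>))\<^sup>2)"
    using E_add_const[OF sq, of 1] by (simp add: add.commute)
  let ?A = "{\<psi>. cl_lip \<psi> \<and> (\<forall>y. \<psi> y \<ge> \<phi> y)}"
  let ?u = "\<lambda>x. g x + \<epsilon> * (1 + (norm x)\<^sup>2)"
  have u: "?u \<in> ?A"
    using close by (auto intro!: cl_lip_add cl_lip_mult cl_lip_const gl cl_lip_norm_power simp: abs_le_iff diff_le_eq add.commute)
  have lower: "E (\<lambda>\<omega>. g (Y \<omega>)) - \<epsilon> * E ?W \<le> E (\<lambda>\<omega>. \<psi> (Y \<omega>))" if "\<psi> \<in> ?A" for \<psi>
  proof -
    have "E (\<lambda>\<omega>. g (Y \<omega>)) \<le> E (\<lambda>\<omega>. \<psi> (Y \<omega>)) + \<epsilon> * E ?W"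
    proof (rule E_le_add_cmult[OF gH _ W \<epsilon>])
      show "(\<lambda>\<omega>. \<psi> (Y \<omega>)) \<in> H" using that by (intro cl_lip_mem[OF Y]) auto
      show "g (Y \<omega>) \<le> \<psi> (Y \<omega>) + \<epsilon> * (1 + (norm (Y \<omega>))\<^sup>2)" for \<omega>
      proof -
        have "\<phi> (Y \<omega>) \<le> \<psi> (Y \<omega>)" using that by blast
        then show ?thesis using close[of "Y \<omega>"] by linarith
      qed
    qed
    then show ?thesis by simp
  qed
  have "ext_expectation E \<phi> Y \<le> E (\<lambda>\<omega>. ?u (Y \<omega>))"
    unfolding ext_expectation_def using lower by (intro cINF_lower u bdd_belowI2)
  also have "\<dots> \<le> E (\<lambda>\<omega>. g (Y \<omega>)) + \<epsilon> * E ?W"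
    by (rule E_le_add_cmult[OF _ gH W \<epsilon>]) (intro add_mem gH cmult_mem W, simp)
  finally have "ext_expectation E \<phi> Y \<le> E (\<lambda>\<omega>. g (Y \<omega>)) + \<epsilon> * E ?W" .
  moreover have "E (\<lambda>\<omega>. g (Y \<omega>)) - \<epsilon> * E ?W \<le> ext_expectation E \<phi> Y"
    unfolding ext_expectation_def using lower u by (intro cINF_greatest) auto
  ultimately show ?thesis by (simp add: EW)
qed

text \<open>The comparison of iterates in both directions, with \<open>s = 1/sqrt n\<close>, gives an error
  \<open>2 L r + L K / sqrt n\<close>, where \<open>K\<close> depends on the radius \<open>r\<close>. The radius is fixed first, in terms of
  the tolerance, and then \<open>n\<close> is taken large.\<close>

lemma clt_lipschitz:
  fixes X :: "nat \<Rightarrow> 'w \<Rightarrow> real ^ 'd" and Z :: "'w \<Rightarrow> real ^ 'd"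
  assumes X: "random_vector H (X 1)" and conv: "convolutionary E X"
    and ident: "\<And>i. i \<ge> 1 \<Longrightarrow> ident_distr E (X i) E (X 1)"
    and centered: "centered E (X 1)" and G: "G_normal H E Z"
    and GA: "\<And>A :: real ^ 'd ^ 'd. transpose A = A \<Longrightarrow> G_fun E Z A = G_fun E (X 1) A"
    and f: "L-lipschitz_on UNIV f"
  shows "(\<lambda>n. E (\<lambda>\<omega>. f ((1 / sqrt (real n)) *\<^sub>R (\<Sum>i=1..n. X i \<omega>)))) \<longlonglongrightarrow> E (\<lambda>\<omega>. f (Z \<omega>))"
proof (rule LIMSEQ_I)
  fix e :: real assume e: "0 < e"
  have L: "0 \<le> L" by (rule lipschitz_on_nonneg[OF f])
  have Z: "random_vector H Z" using G by (simp add: G_normal_def)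
  define r where "r = e / (4 * (L + 1))"
  have r: "0 < r" "2 * L * r < e"
  proof -
    show "0 < r" using e L by (simp add: r_def)
    have "2 * L * r = (L / (L + 1)) * (e / 2)" using L by (simp add: r_def field_simps)
    also have "\<dots> \<le> 1 * (e / 2)" using L e by (intro mult_right_mono) auto
    finally show "2 * L * r < e" using e by simp
  qed
  obtain K where K: "\<And>L (f :: real ^ 'd \<Rightarrow> real) s x. L-lipschitz_on UNIV f \<Longrightarrow> 0 \<le> s \<Longrightarrow> s \<le> 1 \<Longrightarrow>
     \<bar>transition E s (X 1) (mollify r f) x - transition E s Z (mollify r f) x\<bar> \<le> L * K * s ^ 3"
    using transition_close_on_mollified[OF X centered Z G_normal_centered[OF G] GA[symmetric] r(1)] by metis
  have bound: "\<bar>E (\<lambda>\<omega>. f ((1 / sqrt (real n)) *\<^sub>R (\<Sum>i=1..n. X i \<omega>))) - E (\<lambda>\<omega>. f (Z \<omega>))\<bar>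
      \<le> 2 * L * r + L * K * (1 / sqrt (real n))" if n: "1 \<le> n" for n
  proof -
    define s where "s = 1 / sqrt (real n)"
    have s: "0 \<le> s" "s \<le> 1" "s * sqrt (real n) = 1" using n by (simp_all add: s_def)
    have ns: "real n * (L * K * s ^ 3) = L * K * s"
    proof -
      have "real n * (s * s) = 1" using n by (simp add: s_def flip: real_sqrt_mult)
      then show ?thesis by (simp add: power3_eq_cube)
    qed
    let ?Q = "(transition E s (X 1) ^^ n) f 0" and ?P = "(transition E s Z ^^ n) f 0"
    note le = transition_pow_compare[OF _ _ r(1) f, where \<epsilon> = "L * K * s ^ 3" and n = n and s = s and x = 0, unfolded ns]
    have near: "transition E s (X 1) (mollify r g) x \<le> transition E s Z (mollify r g) x + L * K * s ^ 3"
      "transition E s Z (mollify r g) x \<le> transition E s (X 1) (mollify r g) x + L * K * s ^ 3"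
      if "L-lipschitz_on UNIV g" for g and x :: "real ^ 'd"
      using K[OF that s(1,2), of x] by linarith+
    have "?Q \<le> ?P + (2 * L * r + L * K * s)" by (rule le[OF X Z near(1)])
    moreover have "?P \<le> ?Q + (2 * L * r + L * K * s)" by (rule le[OF Z X near(2)])
    moreover have "E (\<lambda>\<omega>. f (s *\<^sub>R (\<Sum>i=1..n. X i \<omega>))) = ?Q"
      by (rule expectation_convolutionary_sum[OF conv ident X f])
    moreover have "?P = E (\<lambda>\<omega>. f (Z \<omega>))"
      using transition_pow_G_normal[OF G f s(1), of n 0] s(3) by simp
    ultimately show ?thesis unfolding s_def[symmetric] by linarith
  qed
  have "(\<lambda>n. sqrt (1 / real n)) \<longlonglongrightarrow> sqrt 0" by (intro tendsto_real_sqrt lim_1_over_n)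
  then have "(\<lambda>n. 2 * L * r + L * K * (1 / sqrt (real n))) \<longlonglongrightarrow> 2 * L * r + L * K * 0"
    by (intro tendsto_intros) (simp add: real_sqrt_divide)
  then have "\<forall>\<^sub>F n in sequentially. 2 * L * r + L * K * (1 / sqrt (real n)) < e"
    using r(2) by (intro order_tendstoD) auto
  then obtain N where N: "\<And>n. N \<le> n \<Longrightarrow> 2 * L * r + L * K * (1 / sqrt (real n)) < e"
    unfolding eventually_sequentially by blast
  show "\<exists>no. \<forall>n\<ge>no. norm (E (\<lambda>\<omega>. f ((1 / sqrt (real n)) *\<^sub>R (\<Sum>i=1..n. X i \<omega>))) - E (\<lambda>\<omega>. f (Z \<omega>))) < e"
  proof (intro exI[of _ "max 1 N"] allI impI)
    fix n assume "max 1 N \<le> n"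
    then show "norm (E (\<lambda>\<omega>. f ((1 / sqrt (real n)) *\<^sub>R (\<Sum>i=1..n. X i \<omega>))) - E (\<lambda>\<omega>. f (Z \<omega>))) < e"
      using bound[of n] N[of n] by simp
  qed
qed

end

theorem theorem9:
  fixes H :: "('w \<Rightarrow> real) set"
    and E :: "('w \<Rightarrow> real) \<Rightarrow> real"
    and X :: "nat \<Rightarrow> 'w \<Rightarrow> real ^ 'd"
    and Z :: "'w \<Rightarrow> real ^ 'd"
    and \<phi> :: "real ^ 'd \<Rightarrow> real"
    and \<delta> C :: real
  assumes "sublinear_expectation_space H E"
    and "\<And>i. i \<ge> 1 \<Longrightarrow> random_vector H (X i)"
    and "convolutionary E X"
    and "\<And>i. i \<ge> 1 \<Longrightarrow> ident_distr E (X i) E (X 1)"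
    and "componentwise E (X 1) = 0"
    and "componentwise (conj_expectation E) (X 1) = 0"
    and "\<delta> > 0"
    and "(\<lambda>\<omega>. norm (X 1 \<omega>) powr (2 + \<delta>)) \<in> H"
    and "random_vector H Z"
    and "G_normal H E Z"
    and "\<And>A :: real ^ 'd ^ 'd. transpose A = A \<Longrightarrow> G_fun E Z A = G_fun E (X 1) A"
    and "continuous_on UNIV \<phi>"
    and "C > 0"
    and "\<And>x. \<bar>\<phi> x\<bar> \<le> C * (1 + norm x)"
  shows "(\<lambda>n. ext_expectation E \<phi> (\<lambda>\<omega>. (1 / sqrt (real n)) *\<^sub>R (\<Sum>i=1..n. X i \<omega>)))
           \<longlonglongrightarrow> ext_expectation E \<phi> Z"
proof (rule LIMSEQ_I)
  interpret sublinear_expectation_space H E by (rule assms(1))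
  note X = assms(2) and conv = assms(3) and ident = assms(4) and Z = assms(9)
  have X1: "random_vector H (X 1)" using X by simp
  have centered: "centered E (X 1)" by (rule centered_of_components[OF X1 assms(5,6)])
  let ?Y = "\<lambda>n \<omega>. (1 / sqrt (real n)) *\<^sub>R (\<Sum>i=1..n. X i \<omega>)"
  let ?m = "\<lambda>Y :: 'w \<Rightarrow> real ^ 'd. E (\<lambda>\<omega>. (norm (Y \<omega>))\<^sup>2)"
  have sq: "(\<lambda>\<omega>. (norm (Y \<omega>))\<^sup>2) \<in> H" if "random_vector H Y" for Y :: "'w \<Rightarrow> real ^ 'd"
    by (rule cl_lip_mem[OF that cl_lip_norm_power])
  have m0: "0 \<le> ?m Y" if "random_vector H Y" for Y :: "'w \<Rightarrow> real ^ 'd"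
    using mono[OF sq[OF that] const_mem[of 0]] by (simp add: const)
  have S: "random_vector H (\<lambda>\<omega>. \<Sum>i=1..n. X i \<omega>)" for n
    by (rule random_vector_sum) (use X in auto)
  have Y: "random_vector H (?Y n)" for n by (rule random_vector_scaleR[OF S])
  have mY: "?m (?Y n) = ?m (X 1)" if "1 \<le> n" for n
  proof -
    have "?m (?Y n) = E (\<lambda>\<omega>. (1 / real n) * (norm (\<Sum>i=1..n. X i \<omega>))\<^sup>2)"
      by (simp add: power_mult_distrib power_divide)
    also have "\<dots> = (1 / real n) * ?m (\<lambda>\<omega>. \<Sum>i=1..n. X i \<omega>)" by (rule pos_hom[OF sq[OF S]]) simp
    finally show ?thesis using that second_moment_convolutionary_sum[OF conv ident X centered, of n] by simp
  qed
  fix e :: real assume e: "0 < e"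
  define B where "B = (1 + ?m (X 1)) + (1 + ?m Z)"
  have B: "0 < B" using m0[OF X1] m0[OF Z] by (simp add: B_def)
  define \<epsilon> where "\<epsilon> = e / (2 * B)"
  have \<epsilon>: "0 < \<epsilon>" "\<epsilon> * B = e / 2" using e B by (simp_all add: \<epsilon>_def)
  obtain L g where g: "L-lipschitz_on UNIV g" and close: "\<And>x. \<bar>\<phi> x - g x\<bar> \<le> \<epsilon> * (1 + (norm x)\<^sup>2)"
    using lipschitz_approximation[OF assms(12-14) \<epsilon>(1)] by metis
  obtain N where N: "\<And>n. N \<le> n \<Longrightarrow> \<bar>E (\<lambda>\<omega>. g (?Y n \<omega>)) - E (\<lambda>\<omega>. g (Z \<omega>))\<bar> < e / 2"
    using LIMSEQ_D[OF clt_lipschitz[OF X1 conv ident centered assms(10,11) g], of "e / 2"] e by auto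
  show "\<exists>no. \<forall>n\<ge>no. norm (ext_expectation E \<phi> (?Y n) - ext_expectation E \<phi> Z) < e"
  proof (intro exI[of _ "max 1 N"] allI impI)
    fix n assume n: "max 1 N \<le> n"
    have "\<bar>ext_expectation E \<phi> (?Y n) - E (\<lambda>\<omega>. g (?Y n \<omega>))\<bar> \<le> \<epsilon> * (1 + ?m (X 1))"
      using ext_expectation_close[OF Y[of n] g _ close] \<epsilon> mY[of n] n by simp
    moreover have "\<bar>ext_expectation E \<phi> Z - E (\<lambda>\<omega>. g (Z \<omega>))\<bar> \<le> \<epsilon> * (1 + ?m Z)"
      using ext_expectation_close[OF Z g _ close] \<epsilon> by simp
    moreover have "\<epsilon> * (1 + ?m (X 1)) + \<epsilon> * (1 + ?m Z) = e / 2"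
      using \<epsilon>(2) unfolding B_def distrib_left .
    ultimately show "norm (ext_expectation E \<phi> (?Y n) - ext_expectation E \<phi> Z) < e"
      using N[of n] n unfolding real_norm_def by linarith
  qed
qed

end
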